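(* Let $\Phi:(\mathbb{R}^m,0)\to(\mathbb{R}^n,0)$ be a rounding. Then $\Phi$ is equivalent to some fractional quadratic rounding, i.e. to a rounding $(\mathbb{R}^m,0)\to(\mathbb{R}^n,0)$ of the form $P/Q$, where $P:\mathbb{R}^m\to\mathbb{R}^n$ is a map given in coordinates by quadratic polynomials and $Q:\mathbb{R}^m\to\mathbb{R}$ is a quadratic polynomial.
   Context: $\mathbb{R}^n$ carries a Euclidean structure. A circle in a Euclidean space means a round Euclidean circle, or a straight line, or a point. A vector line is a line passing through the origin. A rounding is a germ at $0$ of a real analytic map $\Phi:(\mathbb{R}^m,0)\to(\mathbb{R}^n,0)$ (so $\Phi(0)=0$) that takes every germ at $0$ of a vector line to a germ of a circle, i.e. the image of each such germ is contained in a circle. The rank of a rounding is the rank of its first differential at $0$; standing assumption: every rounding has rank at least $2$. Two roundings $\Phi_1,\Phi_2:(\mathbb{R}^m,0)\to(\mathbb{R}^n,0)$ are equivalent if for every germ at $0$ of a vector line $l$ the germs $\Phi_1(l)$ and $\Phi_2(l)$ belong to the same circle. Quadratic polynomials are polynomials of degree at most $2$, not necessarily homogeneous; $P/Q$ denotes the map $x\mapsto P(x)/Q(x)$. *)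

theory Defs
  imports "HOL-Analysis.Analysis"
begin

text \<open>
  Germs at \<open>0\<close> are represented by total functions; all predicates on maps below depend only on
  the behaviour of the map near \<open>0\<close>, apart from the choice of representative
  in \<open>fractional_quadratic_rounding\<close>.
\<close>

text \<open>
  The multi-index power series is summed unconditionally (hence absolutely).
\<close>
definition real_analytic_at :: "(real ^ 'm \<Rightarrow> real ^ 'n) \<Rightarrow> real ^ 'm \<Rightarrow> bool" where
  "real_analytic_at f p \<longleftrightarrow>
     (\<exists>(a :: ('m \<Rightarrow> nat) \<Rightarrow> real ^ 'n) r. r > 0 \<and>
        (\<forall>x \<in> ball p r.
           ((\<lambda>\<alpha>. (\<Prod>i\<in>UNIV. (x $ i - p $ i) ^ \<alpha> i) *\<^sub>R a \<alpha>) has_sum f x) UNIV))"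

definition round_circle :: "(real ^ 'n) set \<Rightarrow> bool" where
  "round_circle C \<longleftrightarrow>
     (\<exists>A c r. affine A \<and> aff_dim A = 2 \<and> c \<in> A \<and> r > 0 \<and> C = A \<inter> sphere c r)"

definition straight_line :: "(real ^ 'n) set \<Rightarrow> bool" where
  "straight_line L \<longleftrightarrow> affine L \<and> aff_dim L = 1"

definition is_circle :: "(real ^ 'n) set \<Rightarrow> bool" where
  "is_circle C \<longleftrightarrow> round_circle C \<or> straight_line C \<or> (\<exists>p. C = {p})"

definition vector_line :: "(real ^ 'm) set \<Rightarrow> bool" where
  "vector_line l \<longleftrightarrow> straight_line l \<and> 0 \<in> l"

text \<open>
  The image under \<open>f\<close> of the germ of \<open>l\<close> at \<open>0\<close> is contained in \<open>C\<close>; the neighbourhood of \<open>0\<close>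
  may depend on \<open>l\<close>.
\<close>
definition germ_image_in ::
  "(real ^ 'm \<Rightarrow> real ^ 'n) \<Rightarrow> (real ^ 'm) set \<Rightarrow> (real ^ 'n) set \<Rightarrow> bool" where
  "germ_image_in f l C \<longleftrightarrow> (\<exists>U. open U \<and> 0 \<in> U \<and> f ` (l \<inter> U) \<subseteq> C)"

definition rank_at_0 :: "(real ^ 'm \<Rightarrow> real ^ 'n) \<Rightarrow> nat" where
  "rank_at_0 f = dim (range (frechet_derivative f (at 0)))"

text \<open>The standing assumption that the rank is at least \<open>2\<close> is part of the definition.\<close>
definition rounding :: "(real ^ 'm \<Rightarrow> real ^ 'n) \<Rightarrow> bool" where
  "rounding \<Phi> \<longleftrightarrow>
     real_analytic_at \<Phi> 0 \<and> \<Phi> 0 = 0 \<and>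
     (\<forall>l. vector_line l \<longrightarrow> (\<exists>C. is_circle C \<and> germ_image_in \<Phi> l C)) \<and>
     rank_at_0 \<Phi> \<ge> 2"

definition equivalent_roundings ::
  "(real ^ 'm \<Rightarrow> real ^ 'n) \<Rightarrow> (real ^ 'm \<Rightarrow> real ^ 'n) \<Rightarrow> bool" where
  "equivalent_roundings \<Phi>\<^sub>1 \<Phi>\<^sub>2 \<longleftrightarrow>
     (\<forall>l. vector_line l \<longrightarrow>
        (\<exists>C. is_circle C \<and> germ_image_in \<Phi>\<^sub>1 l C \<and> germ_image_in \<Phi>\<^sub>2 l C))"

text \<open>Degree at most \<open>2\<close>, not necessarily homogeneous.\<close>
definition quadratic_polynomial :: "(real ^ 'm \<Rightarrow> real) \<Rightarrow> bool" where
  "quadratic_polynomial q \<longleftrightarrow>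
     (\<exists>(a :: 'm \<Rightarrow> 'm \<Rightarrow> real) (b :: 'm \<Rightarrow> real) c. \<forall>x.
        q x = (\<Sum>i\<in>UNIV. \<Sum>j\<in>UNIV. a i j * x $ i * x $ j) + (\<Sum>i\<in>UNIV. b i * x $ i) + c)"

text \<open>
  \<open>Q 0 \<noteq> 0\<close> makes \<open>P/Q\<close> a genuine quotient near \<open>0\<close>, independent of the convention for division
  by zero.
\<close>
definition fractional_quadratic_rounding :: "(real ^ 'm \<Rightarrow> real ^ 'n) \<Rightarrow> bool" where
  "fractional_quadratic_rounding \<Psi> \<longleftrightarrow>
     rounding \<Psi> \<and>
     (\<exists>(P :: real ^ 'm \<Rightarrow> real ^ 'n) (Q :: real ^ 'm \<Rightarrow> real).
        (\<forall>k. quadratic_polynomial (\<lambda>x. P x $ k)) \<and> quadratic_polynomial Q \<and> Q 0 \<noteq> 0 \<and>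
        \<Psi> = (\<lambda>x. P x /\<^sub>R Q x))"

end

theory Submission
  imports Defs "HOL-Computational_Algebra.Polynomial"
begin

text \<open>
  Write \<open>\<Phi> = A + B + C + D + O(5)\<close> with homogeneous terms of degree \<open>1, 2, 3, 4\<close>. If \<open>A x \<noteq> 0\<close>, the circle
  containing the image of the line through \<open>x\<close> is determined by \<open>A x\<close> and by \<open>B x\<close> modulo \<open>A x\<close>, and
  comparing coefficients in the equation of the circle gives
  \<open>\<bar>A\<bar>\<^sup>2 (C \<and> A) = 2 \<langle>A, B\<rangle> (B \<and> A)\<close> and \<open>\<bar>A\<bar>\<^sup>2 (D \<and> A) = (\<bar>B\<bar>\<^sup>2 + 2 \<langle>A, C\<rangle>) (B \<and> A)\<close>.
  Evaluated on the complex cone \<open>\<langle>A, A\<rangle> = 0\<close>, these force first \<open>\<langle>A, B\<rangle> = 0\<close> and then \<open>\<langle>B, B\<rangle> = 0\<close> there.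
  As \<open>A\<close> has rank at least \<open>2\<close>, the form \<open>\<bar>A\<bar>\<^sup>2\<close> is squarefree, so \<open>\<langle>A, B\<rangle> = l \<bar>A\<bar>\<^sup>2\<close> with \<open>l\<close> linear and
  \<open>\<bar>B\<bar>\<^sup>2 = g \<bar>A\<bar>\<^sup>2\<close> with \<open>g\<close> quadratic. Then \<open>B' = B - l A\<close> is orthogonal to \<open>A\<close> with
  \<open>\<bar>B'\<bar>\<^sup>2 = q \<bar>A\<bar>\<^sup>2\<close> for \<open>q = g - l\<^sup>2\<close>, and \<open>(A + B') / (1 + q)\<close> parametrises the same circles.
\<close>

section \<open>Divisibility by the squared norm of a linear map\<close>

text \<open>If \<open>?F\<close> were nonzero, \<open>a\<close> and \<open>b\<close> would be
  parallel; contracting the parallelism with the isotropic vector \<open>a\<close> gives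
  \<open>a i * ?F = 0\<close> for all \<open>i\<close>, so \<open>a\<close> and hence
  \<open>?F\<close> vanish. The pairing is bilinear, not Hermitian, so an isotropic vector need not
  be zero.\<close>

lemma isotropic_dot_zero:
  fixes a b :: "'n::finite \<Rightarrow> complex"
  assumes "(\<Sum>i\<in>UNIV. a i * a i) = 0"
    and "\<And>i j. (\<Sum>k\<in>UNIV. a k * b k) * (b i * a j - b j * a i) = 0"
  shows "(\<Sum>k\<in>UNIV. a k * b k) = 0"
proof (rule ccontr)
  let ?F = "\<Sum>k\<in>UNIV. a k * b k"
  assume F: "?F \<noteq> 0"
  then have par: "b i * a j = b j * a i" for i j
    using assms(2)[of i j] by simp
  have "a i = 0" for i
  proof -
    have "b i * (\<Sum>j\<in>UNIV. a j * a j) = (\<Sum>j\<in>UNIV. (b i * a j) * a j)"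
      by (simp add: sum_distrib_left mult_ac)
    also have "\<dots> = (\<Sum>j\<in>UNIV. (b j * a i) * a j)"
      using par by simp
    also have "\<dots> = a i * ?F"
      by (simp add: sum_distrib_left mult_ac)
    finally show ?thesis using assms(1) F by simp
  qed
  then show False using F by simp
qed

text \<open>Contracting the last relation with \<open>a\<close> kills every term except the product
  of \<open>a i\<close> with the pairing of \<open>a\<close> and \<open>c\<close>. This removes the
  mixed term \<open>2 * (A \<bullet> C)\<close> from the fourth-order identity on the isotropic
  cone.\<close>

lemma isotropic_dot_zero_mod:
  fixes a b c :: "'n::finite \<Rightarrow> complex"
  assumes "(\<Sum>i\<in>UNIV. a i * a i) = 0" and "(\<Sum>i\<in>UNIV. a i * b i) = 0"
    and "\<And>i j. c i * a j - c j * a i = m * (b i * a j - b j * a i)"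
  shows "(\<Sum>i\<in>UNIV. a i * c i) = 0"
proof (rule ccontr)
  assume H: "(\<Sum>i\<in>UNIV. a i * c i) \<noteq> 0"
  have "a i = 0" for i
  proof -
    have "(\<Sum>j\<in>UNIV. (c i * a j - c j * a i) * a j) = (\<Sum>j\<in>UNIV. m * (b i * a j - b j * a i) * a j)"
      using assms(3) by simp
    then have "c i * (\<Sum>j\<in>UNIV. a j * a j) - a i * (\<Sum>j\<in>UNIV. a j * c j) =
       m * (b i * (\<Sum>j\<in>UNIV. a j * a j) - a i * (\<Sum>j\<in>UNIV. a j * b j))"
      by (simp add: sum_distrib_left algebra_simps sum_subtractf)
    then show ?thesis using assms(1,2) H by simp
  qed
  then show False using H by simp
qed

text \<open>Here parallelism is contracted with \<open>b\<close> instead of \<open>a\<close>: it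
  turns \<open>a k * ?G\<close> into \<open>b k\<close> times the pairing of \<open>a\<close> and
  \<open>b\<close>, which is zero.\<close>

lemma isotropic_square_zero:
  fixes a b :: "'n::finite \<Rightarrow> complex"
  assumes "(\<Sum>i\<in>UNIV. a i * b i) = 0" and "a k \<noteq> 0"
    and "\<And>i j. (\<Sum>k\<in>UNIV. b k * b k) * (b i * a j - b j * a i) = 0"
  shows "(\<Sum>i\<in>UNIV. b i * b i) = 0"
proof (rule ccontr)
  let ?G = "\<Sum>k\<in>UNIV. b k * b k"
  assume G: "?G \<noteq> 0"
  then have par: "b i * a j = b j * a i" for i j
    using assms(3)[of i j] by simp
  have "a k * ?G = (\<Sum>i\<in>UNIV. b i * (b i * a k))"
    by (simp add: sum_distrib_left mult_ac)
  also have "\<dots> = (\<Sum>i\<in>UNIV. b i * (b k * a i))"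
    using par[of _ k] by simp
  also have "\<dots> = b k * (\<Sum>i\<in>UNIV. a i * b i)"
    by (simp add: sum_distrib_left mult_ac)
  finally show False using assms(1,2) G by simp
qed

text \<open>A nonzero polynomial has finitely many roots. Identities known for real parameters thus
  become polynomial identities, in which nonzero factors cancel and non-real values may be
  substituted.\<close>

lemma poly_eq_on_reals:
  fixes p q :: "complex poly"
  assumes "\<And>u::real. poly p (of_real u) = poly q (of_real u)"
  shows "p = q"
proof (rule ccontr)
  assume "p \<noteq> q"
  then have "finite {z. poly (p - q) z = 0}"
    by (intro poly_roots_finite) simp
  moreover have "range (of_real :: real \<Rightarrow> complex) \<subseteq> {z. poly (p - q) z = 0}"
    using assms by auto
  ultimately have "finite (range (of_real :: real \<Rightarrow> complex))"
    using finite_subset by blast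
  then show False
    by (metis finite_imageD infinite_UNIV_char_0 inj_of_real)
qed

lemma inner_vec_sum: "x \<bullet> y = (\<Sum>i\<in>UNIV. x $ i * y $ i)" for x y :: "real ^ 'n"
  by (simp add: inner_vec_def)

text \<open>
  The quadratic form \<open>\<bar>A\<bar>\<^sup>2\<close> restricted to the line is \<open>u\<^sup>2 + s\<close>; evaluating the identities at its complex
  root \<open>\<i> \<surd>s\<close> makes \<open>\<langle>A, B\<rangle>\<close> and \<open>\<bar>B\<bar>\<^sup>2\<close> vanish there, which gives the divisibility relations between coefficients.
\<close>
lemma divisibility_on_line:
  fixes p q :: "real ^ 'n" and B C D :: "real \<Rightarrow> real ^ 'n" and b0 b1 b2 :: "real ^ 'n"
  defines "A \<equiv> \<lambda>u. u *\<^sub>R p + q"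
  assumes unit: "p \<bullet> p = 1" and orth: "p \<bullet> q = 0" and q0: "q \<noteq> 0"
    and B: "\<And>u. B u = b0 + u *\<^sub>R b1 + u\<^sup>2 *\<^sub>R b2"
    and polyC: "\<And>i. \<exists>r. \<forall>u. poly r (complex_of_real u) = complex_of_real (C u $ i)"
    and polyD: "\<And>i. \<exists>r. \<forall>u. poly r (complex_of_real u) = complex_of_real (D u $ i)"
    and third: "\<And>u i j. (A u \<bullet> A u) * (C u $ i * A u $ j - C u $ j * A u $ i) =
        2 * (A u \<bullet> B u) * (B u $ i * A u $ j - B u $ j * A u $ i)"
    and fourth: "\<And>u i j. (A u \<bullet> A u) * (D u $ i * A u $ j - D u $ j * A u $ i) =
        (B u \<bullet> B u + 2 * (A u \<bullet> C u)) * (B u $ i * A u $ j - B u $ j * A u $ i)"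
  shows "A u \<bullet> B u = (u * (p \<bullet> b2) + (q \<bullet> b2 + p \<bullet> b1)) * (A u \<bullet> A u)" (is ?cubic)
    and "B u \<bullet> B u = (u\<^sup>2 * (b2 \<bullet> b2) + u * (2 * (b1 \<bullet> b2)) + (b1 \<bullet> b1 + 2 * (b0 \<bullet> b2) - (q \<bullet> q) * (b2 \<bullet> b2)))
            * (A u \<bullet> A u)" (is ?quartic)
proof -
  define s where "s = q \<bullet> q"
  have s: "s > 0" using q0 by (simp add: s_def)
  define z where "z = \<i> * complex_of_real (sqrt s)"
  have zz: "z * z = - complex_of_real s"
    using s by (simp add: z_def complex_eq_iff)
  \<comment> \<open>Reduction of a quartic modulo \<open>z * z = - s\<close>: the two groups are the
    coefficients of its remainder after division by \<open>u\<^sup>2 + s\<close>.\<close>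
  have eval_z: "poly [:f0, f1, f2, f3, f4:] z =
      f0 - complex_of_real s * f2 + complex_of_real s * complex_of_real s * f4 +
      z * (f1 - complex_of_real s * f3)" for f0 f1 f2 f3 f4
  proof -
    have "poly [:f0, f1, f2, f3, f4:] z = f0 + z * f1 + (z * z) * f2 + z * (z * z) * f3 + (z * z) * (z * z) * f4"
      by (simp add: algebra_simps)
    then show ?thesis unfolding zz by (simp add: algebra_simps)
  qed
  \<comment> \<open>As \<open>z\<close> is a nonzero imaginary number, vanishing at \<open>z\<close>
    splits into two real equations, one for each coefficient of the remainder.\<close>
  have z_eval: "x = 0 \<and> y = 0" if "complex_of_real x + z * complex_of_real y = 0" for x y
    using that s by (auto simp: z_def complex_eq_iff)
  define a where "a i = [:complex_of_real (q $ i), complex_of_real (p $ i):]" for i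
  define b where "b i = [:complex_of_real (b0 $ i), complex_of_real (b1 $ i), complex_of_real (b2 $ i):]" for i
  from polyC obtain c where c: "\<And>i u. poly (c i) (complex_of_real u) = complex_of_real (C u $ i)" by metis
  from polyD obtain d where d: "\<And>i u. poly (d i) (complex_of_real u) = complex_of_real (D u $ i)" by metis
  have a: "poly (a i) (complex_of_real u) = complex_of_real (A u $ i)" for i u
    by (simp add: a_def A_def)
  have b: "poly (b i) (complex_of_real u) = complex_of_real (B u $ i)" for i u
    by (simp add: b_def B power2_eq_square algebra_simps)
  define N where "N = (\<Sum>i\<in>UNIV. a i * a i)"
  define F where "F = (\<Sum>i\<in>UNIV. a i * b i)"
  define G where "G = (\<Sum>i\<in>UNIV. b i * b i)"
  define H where "H = (\<Sum>i\<in>UNIV. a i * c i)"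
  have N: "poly N (complex_of_real u) = complex_of_real (A u \<bullet> A u)" for u
    by (simp add: N_def poly_sum a inner_vec_sum)
  have F: "poly F (complex_of_real u) = complex_of_real (A u \<bullet> B u)" for u
    by (simp add: F_def poly_sum a b inner_vec_sum)
  have G: "poly G (complex_of_real u) = complex_of_real (B u \<bullet> B u)" for u
    by (simp add: G_def poly_sum b inner_vec_sum)
  have H: "poly H (complex_of_real u) = complex_of_real (A u \<bullet> C u)" for u
    by (simp add: H_def poly_sum a c inner_vec_sum)
  have AA: "A u \<bullet> A u = u\<^sup>2 + s" for u
    using unit orth by (simp add: A_def s_def inner_simps inner_commute power2_eq_square)
  have N_eq: "N = [:complex_of_real s, 0, 1:]"
    by (rule poly_eq_on_reals) (simp add: N AA power2_eq_square)
  then have Nz: "poly N z = 0" using zz by simp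
  have N0: "N \<noteq> 0" using N_eq by simp
  have third': "N * (c i * a j - c j * a i) = 2 * F * (b i * a j - b j * a i)" for i j
  proof (rule poly_eq_on_reals)
    fix u :: real
    show "poly (N * (c i * a j - c j * a i)) (complex_of_real u) = poly (2 * F * (b i * a j - b j * a i)) (complex_of_real u)"
      using arg_cong[OF third[of u i j], of complex_of_real]
      by (simp only: of_real_mult of_real_diff of_real_numeral poly_mult poly_diff poly_numeral N F a b c)
  qed
  have fourth': "N * (d i * a j - d j * a i) = (G + 2 * H) * (b i * a j - b j * a i)" for i j
  proof (rule poly_eq_on_reals)
    fix u :: real
    show "poly (N * (d i * a j - d j * a i)) (complex_of_real u) = poly ((G + 2 * H) * (b i * a j - b j * a i)) (complex_of_real u)"
      using arg_cong[OF fourth[of u i j], of complex_of_real]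
      by (simp only: of_real_mult of_real_diff of_real_add of_real_numeral poly_mult poly_diff poly_add poly_numeral N G H a b d)
  qed
  have Nz': "(\<Sum>i\<in>UNIV. poly (a i) z * poly (a i) z) = 0"
    using Nz by (simp add: N_def poly_sum)
  have Fz: "poly F z = 0"
  proof -
    have "poly F z * (poly (b i) z * poly (a j) z - poly (b j) z * poly (a i) z) = 0" for i j
      using arg_cong[OF third'[of i j], of "\<lambda>p. poly p z"] Nz by simp
    then show ?thesis
      using isotropic_dot_zero[OF Nz', of "\<lambda>i. poly (b i) z"] by (simp add: F_def poly_sum)
  qed
  have Fz': "(\<Sum>i\<in>UNIV. poly (a i) z * poly (b i) z) = 0"
    using Fz by (simp add: F_def poly_sum)
  have F_eq: "F = [:complex_of_real (q \<bullet> b0), complex_of_real (p \<bullet> b0 + q \<bullet> b1),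
      complex_of_real (q \<bullet> b2 + p \<bullet> b1), complex_of_real (p \<bullet> b2), 0:]"
    by (rule poly_eq_on_reals) (simp add: F A_def B inner_simps power2_eq_square algebra_simps)
  have F_z: "complex_of_real (q \<bullet> b0 - s * (q \<bullet> b2 + p \<bullet> b1)) +
      z * complex_of_real (p \<bullet> b0 + q \<bullet> b1 - s * (p \<bullet> b2)) = poly F z"
    unfolding F_eq eval_z by (simp add: algebra_simps)
  have cub: "q \<bullet> b0 = s * (q \<bullet> b2 + p \<bullet> b1)" "p \<bullet> b0 + q \<bullet> b1 = s * (p \<bullet> b2)"
    using z_eval[OF F_z[unfolded Fz]] by simp_all
  have cubic: "A u \<bullet> B u = (u * (p \<bullet> b2) + (q \<bullet> b2 + p \<bullet> b1)) * (A u \<bullet> A u)" for u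
  proof -
    have "A u \<bullet> B u = q \<bullet> b0 + u * (p \<bullet> b0 + q \<bullet> b1) + u\<^sup>2 * (q \<bullet> b2 + p \<bullet> b1) + u^3 * (p \<bullet> b2)"
      by (simp add: A_def B inner_simps power2_eq_square power3_eq_cube algebra_simps)
    then show ?thesis unfolding AA cub by (simp add: power2_eq_square power3_eq_cube algebra_simps)
  qed
  then show ?cubic .
  define L where "L = [:complex_of_real (q \<bullet> b2 + p \<bullet> b1), complex_of_real (p \<bullet> b2):]"
  have FLN: "F = L * N"
    by (rule poly_eq_on_reals) (simp add: F N cubic L_def algebra_simps)
  \<comment> \<open>Evaluating \<open>third'\<close> at \<open>z\<close> gives only
    \<open>0 = 0\<close>. With \<open>F = L * N\<close> the factor \<open>N\<close> cancels first,
    and the resulting relation carries information at \<open>z\<close>.\<close>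
  have "c i * a j - c j * a i = 2 * L * (b i * a j - b j * a i)" for i j
  proof -
    have "N * (c i * a j - c j * a i) = N * (2 * L * (b i * a j - b j * a i))"
      using third'[of i j] by (simp add: FLN algebra_simps)
    then show ?thesis using N0 by (metis mult_cancel_left)
  qed
  then have par: "poly (c i) z * poly (a j) z - poly (c j) z * poly (a i) z =
     poly (2 * L) z * (poly (b i) z * poly (a j) z - poly (b j) z * poly (a i) z)" for i j
    by (metis poly_diff poly_mult)
  have Hz: "poly H z = 0"
    using isotropic_dot_zero_mod[OF Nz' Fz' par] by (simp add: H_def poly_sum)
  have Gz: "poly G z = 0"
  proof -
    have GG: "poly G z * (poly (b i) z * poly (a j) z - poly (b j) z * poly (a i) z) = 0" for i j
      using arg_cong[OF fourth'[of i j], of "\<lambda>p. poly p z"] Nz Hz by simp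
    have "p \<noteq> 0" using unit by auto
    then obtain k where "p $ k \<noteq> 0" by (auto simp: vec_eq_iff)
    \<comment> \<open>The imaginary part of this value is \<open>sqrt s * p $ k\<close>.\<close>
    then have "poly (a k) z \<noteq> 0" using s by (auto simp: a_def z_def complex_eq_iff)
    then show ?thesis
      using isotropic_square_zero[OF Fz', of k] GG by (simp add: G_def poly_sum)
  qed
  have BB: "B u \<bullet> B u = b0 \<bullet> b0 + u * (2 * (b0 \<bullet> b1)) + u\<^sup>2 * (b1 \<bullet> b1 + 2 * (b0 \<bullet> b2)) + u^3 * (2 * (b1 \<bullet> b2))
      + u^4 * (b2 \<bullet> b2)" for u
    by (simp add: B inner_simps power2_eq_square power3_eq_cube power4_eq_xxxx algebra_simps inner_commute)
  have G_eq: "G = [:complex_of_real (b0 \<bullet> b0), complex_of_real (2 * (b0 \<bullet> b1)),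
      complex_of_real (b1 \<bullet> b1 + 2 * (b0 \<bullet> b2)), complex_of_real (2 * (b1 \<bullet> b2)), complex_of_real (b2 \<bullet> b2):]"
    by (rule poly_eq_on_reals) (simp add: G BB power2_eq_square power3_eq_cube power4_eq_xxxx algebra_simps)
  have G_z: "complex_of_real (b0 \<bullet> b0 - s * (b1 \<bullet> b1 + 2 * (b0 \<bullet> b2) - s * (b2 \<bullet> b2))) +
      z * complex_of_real (2 * (b0 \<bullet> b1) - s * (2 * (b1 \<bullet> b2))) = poly G z"
    unfolding G_eq eval_z by (simp add: algebra_simps)
  have quar: "b0 \<bullet> b0 = s * (b1 \<bullet> b1 + 2 * (b0 \<bullet> b2) - s * (b2 \<bullet> b2))" "2 * (b0 \<bullet> b1) = s * (2 * (b1 \<bullet> b2))"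
    using z_eval[OF G_z[unfolded Gz]] by simp_all
  show ?quartic unfolding BB AA quar s_def[symmetric]
    by (simp add: power2_eq_square power3_eq_cube power4_eq_xxxx algebra_simps)
qed

section \<open>Taylor expansion of real analytic maps\<close>

text \<open>Homogeneous polynomial maps of degree \<open>k\<close>, built by splitting off one
  coordinate factor at a time. The maps \<open>g i\<close> are not unique; the recursive form lets
  proofs run by induction on the degree without multi-indices.\<close>

primrec homogeneous :: "nat \<Rightarrow> (real ^ 'm \<Rightarrow> real ^ 'n) \<Rightarrow> bool" where
  "homogeneous 0 f \<longleftrightarrow> (\<exists>v. f = (\<lambda>_. v))"
| "homogeneous (Suc k) f \<longleftrightarrow> (\<exists>g. (\<forall>i. homogeneous k (g i)) \<and> f = (\<lambda>x. \<Sum>i\<in>UNIV. x $ i *\<^sub>R g i x))"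

lemma homogeneous_zero: "homogeneous k (\<lambda>_. 0)"
proof (induction k)
  case (Suc k)
  then show ?case by (auto intro!: exI[of _ "\<lambda>_ _. 0"])
qed auto

lemma homogeneous_add: "homogeneous k f \<Longrightarrow> homogeneous k g \<Longrightarrow> homogeneous k (\<lambda>x. f x + g x)"
proof (induction k arbitrary: f g)
  case (Suc k)
  then obtain f' g' where f': "\<And>i. homogeneous k (f' i)" "f = (\<lambda>x. \<Sum>i\<in>UNIV. x $ i *\<^sub>R f' i x)"
    and g': "\<And>i. homogeneous k (g' i)" "g = (\<lambda>x. \<Sum>i\<in>UNIV. x $ i *\<^sub>R g' i x)"
    by auto
  show ?case unfolding homogeneous.simps
    by (rule exI[of _ "\<lambda>i x. f' i x + g' i x"])
       (simp add: f' g' Suc.IH scaleR_add_right sum.distrib)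
qed auto

lemma homogeneous_sum:
  assumes "\<And>a. a \<in> S \<Longrightarrow> homogeneous k (f a)"
  shows "homogeneous k (\<lambda>x. \<Sum>a\<in>S. f a x)"
  using assms by (induction S rule: infinite_finite_induct) (auto intro: homogeneous_zero homogeneous_add)

lemma homogeneous_scaleR:
  "homogeneous k f \<Longrightarrow> f (t *\<^sub>R x) = t ^ k *\<^sub>R f x"
proof (induction k arbitrary: f)
  case (Suc k)
  then obtain g where g: "\<And>i. homogeneous k (g i)" "f = (\<lambda>x. \<Sum>i\<in>UNIV. x $ i *\<^sub>R g i x)"
    by auto
  then show ?case using Suc.IH[OF g(1)] by (simp add: scaleR_sum_right mult_ac)
qed auto

text \<open>For positive degree some exponent \<open>\<alpha> j\<close> is positive; one factor
  \<open>x $ j\<close> is split off, and all other coefficient maps are taken to be zero.\<close>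

lemma homogeneous_monomial:
  fixes \<alpha> :: "'m::finite \<Rightarrow> nat"
  assumes "sum \<alpha> UNIV = k"
  shows "homogeneous k (\<lambda>x. (\<Prod>i\<in>UNIV. (x $ i) ^ \<alpha> i) *\<^sub>R v)"
  using assms
proof (induction k arbitrary: \<alpha>)
  case 0
  then have "\<alpha> i = 0" for i by simp
  then show ?case by auto
next
  case (Suc k)
  have "\<exists>j. \<alpha> j > 0"
  proof (rule ccontr)
    assume "\<not> (\<exists>j. \<alpha> j > 0)"
    then have "sum \<alpha> UNIV = 0" by simp
    with Suc.prems show False by simp
  qed
  then obtain j where j: "\<alpha> j > 0" by blast
  define \<beta> where "\<beta> = \<alpha>(j := \<alpha> j - 1)"
  have "sum \<alpha> UNIV = \<alpha> j + sum \<alpha> (UNIV - {j})"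
    by (rule sum.remove) auto
  moreover have "sum \<beta> UNIV = \<beta> j + sum \<beta> (UNIV - {j})"
    by (rule sum.remove) auto
  moreover have "sum \<beta> (UNIV - {j}) = sum \<alpha> (UNIV - {j})"
    by (rule sum.cong) (auto simp: \<beta>_def)
  ultimately have "sum \<beta> UNIV = k"
    using Suc.prems j by (simp add: \<beta>_def)
  note hom = Suc.IH[OF this]
  have prod: "(\<Prod>i\<in>UNIV. (x $ i) ^ \<alpha> i) = x $ j * (\<Prod>i\<in>UNIV. (x $ i) ^ \<beta> i)" for x :: "real ^ 'm"
  proof -
    have "(\<Prod>i\<in>UNIV. (x $ i) ^ \<alpha> i) = (x $ j) ^ \<alpha> j * (\<Prod>i\<in>UNIV - {j}. (x $ i) ^ \<alpha> i)"
      by (rule prod.remove) auto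
    moreover have "(\<Prod>i\<in>UNIV. (x $ i) ^ \<beta> i) = (x $ j) ^ \<beta> j * (\<Prod>i\<in>UNIV - {j}. (x $ i) ^ \<beta> i)"
      by (rule prod.remove) auto
    moreover have "(\<Prod>i\<in>UNIV - {j}. (x $ i) ^ \<beta> i) = (\<Prod>i\<in>UNIV - {j}. (x $ i) ^ \<alpha> i)"
      by (rule prod.cong) (auto simp: \<beta>_def)
    moreover have "(x $ j) ^ \<alpha> j = x $ j * (x $ j) ^ \<beta> j"
      using j by (cases "\<alpha> j") (auto simp: \<beta>_def)
    ultimately show ?thesis by (simp only: mult.assoc)
  qed
  show ?case unfolding homogeneous.simps
  proof (intro exI conjI allI ext)
    show "homogeneous k (if i = j then (\<lambda>x. (\<Prod>i\<in>UNIV. (x $ i) ^ \<beta> i) *\<^sub>R v) else (\<lambda>_. 0))" for i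
      using hom by (simp add: homogeneous_zero)
    show "(\<Prod>i\<in>UNIV. (x $ i) ^ \<alpha> i) *\<^sub>R v =
      (\<Sum>i\<in>UNIV. x $ i *\<^sub>R (if i = j then (\<lambda>x. (\<Prod>i\<in>UNIV. (x $ i) ^ \<beta> i) *\<^sub>R v) else (\<lambda>_. 0)) x)" for x
    proof -
      have "(\<Sum>i\<in>UNIV. x $ i *\<^sub>R (if i = j then (\<lambda>x. (\<Prod>i\<in>UNIV. (x $ i) ^ \<beta> i) *\<^sub>R v) else (\<lambda>_. 0)) x) =
          (\<Sum>i\<in>UNIV. if i = j then x $ i *\<^sub>R (\<Prod>i\<in>UNIV. (x $ i) ^ \<beta> i) *\<^sub>R v else 0)"
        by (rule sum.cong) auto
      then show ?thesis by (simp add: prod)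
    qed
  qed
qed

lemma homogeneous_1E:
  assumes "homogeneous (Suc 0) f"
  obtains v where "f = (\<lambda>x. \<Sum>i\<in>UNIV. x $ i *\<^sub>R v i)"
proof -
  from assms obtain g where g: "\<And>i. homogeneous 0 (g i)" and f: "f = (\<lambda>x. \<Sum>i\<in>UNIV. x $ i *\<^sub>R g i x)"
    unfolding homogeneous.simps(2) by (elim exE conjE) blast
  from g have "\<forall>i. \<exists>v. g i = (\<lambda>_. v)" unfolding homogeneous.simps(1) by (intro allI)
  then obtain v where "\<And>i. g i = (\<lambda>_. v i)" by (elim choice[THEN exE]) blast
  with f show ?thesis by (intro that[of v]) simp
qed

lemma homogeneous_linear:
  fixes f :: "real ^ 'm \<Rightarrow> real ^ 'n"
  assumes "homogeneous (Suc 0) f"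
  shows "linear f"
proof -
  from assms obtain v where f: "f = (\<lambda>x. \<Sum>i\<in>UNIV. x $ i *\<^sub>R v i)"
    by (rule homogeneous_1E)
  have "linear (\<lambda>x::real ^ 'm. x $ i *\<^sub>R v i)" for i
    by (intro linearI) (auto simp: algebra_simps)
  then show ?thesis unfolding f by (intro linear_compose_sum) auto
qed

lemma homogeneous_quadratic:
  fixes f :: "real ^ 'm \<Rightarrow> real ^ 'n"
  assumes "homogeneous 2 f"
  obtains b where "bilinear b" "\<And>x y. b x y = b y x" "\<And>x. f x = b x x"
proof -
  obtain g v where f: "f = (\<lambda>x. \<Sum>i\<in>UNIV. x $ i *\<^sub>R g i x)"
    and g: "\<And>i. g i = (\<lambda>x. \<Sum>j\<in>UNIV. x $ j *\<^sub>R v i j)"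
  proof -
    from assms obtain g where g: "\<And>i. homogeneous (Suc 0) (g i)" and f: "f = (\<lambda>x. \<Sum>i\<in>UNIV. x $ i *\<^sub>R g i x)"
      unfolding numeral_2_eq_2 homogeneous.simps(2)[of "Suc 0"] by blast
    have "\<forall>i. \<exists>v. g i = (\<lambda>x. \<Sum>j\<in>UNIV. x $ j *\<^sub>R v j)"
      by (intro allI, rule homogeneous_1E[OF g]) blast
    then obtain v where "\<And>i. g i = (\<lambda>x. \<Sum>j\<in>UNIV. x $ j *\<^sub>R v i j)"
      by (elim choice[THEN exE]) blast
    with f show ?thesis by (rule that)
  qed
  \<comment> \<open>Averaging over both orders of the arguments makes \<open>b\<close> symmetric and
    keeps its diagonal.\<close>
  define b where "b x y = (\<Sum>i\<in>UNIV. \<Sum>j\<in>UNIV. ((x $ i * y $ j + y $ i * x $ j) / 2) *\<^sub>R v i j)" for x y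
  show ?thesis
  proof
    have "linear (\<lambda>y::real ^ 'm. ((x $ i * y $ j + y $ i * x $ j) / 2) *\<^sub>R v i j)"
      "linear (\<lambda>x::real ^ 'm. ((x $ i * y $ j + y $ i * x $ j) / 2) *\<^sub>R v i j)" for x y i j
      by (auto intro!: linearI simp: add_divide_distrib algebra_simps)
    then show "bilinear b" unfolding bilinear_def b_def
      by (intro conjI allI linear_compose_sum ballI)
    show "b x y = b y x" for x y by (simp add: b_def add.commute)
    show "f x = b x x" for x by (simp add: b_def f g scaleR_sum_right)
  qed
qed

text \<open>Complex coefficients are used so that the restriction to the line can later be evaluated
  at the complex root of the norm form.\<close>

lemma homogeneous_poly_on_line:
  assumes "homogeneous k f"
  shows "\<exists>r. \<forall>u. poly r (complex_of_real u) = complex_of_real (f (u *\<^sub>R e + w) $ l)"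
  using assms
proof (induction k arbitrary: f)
  case 0
  then obtain v where "f = (\<lambda>_. v)" by auto
  then show ?case by (auto intro!: exI[of _ "[:complex_of_real (v $ l):]"])
next
  case (Suc k)
  then obtain g where g: "\<And>i. homogeneous k (g i)" and f: "f = (\<lambda>x. \<Sum>i\<in>UNIV. x $ i *\<^sub>R g i x)"
    by auto
  from Suc.IH[OF g] obtain r
    where r: "\<And>i u. poly (r i) (complex_of_real u) = complex_of_real (g i (u *\<^sub>R e + w) $ l)"
    by metis
  show ?case
    by (rule exI[of _ "\<Sum>i\<in>UNIV. [:complex_of_real (w $ i), complex_of_real (e $ i):] * r i"])
       (simp add: poly_sum r f sum_component algebra_simps)
qed

section \<open>Estimates for multi-index power series\<close>

lemma finite_multi_indices: "finite {\<alpha> :: 'm::finite \<Rightarrow> nat. sum \<alpha> UNIV < k}"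
proof (rule finite_subset)
  have "\<alpha> i \<le> sum \<alpha> UNIV" for \<alpha> :: "'m \<Rightarrow> nat" and i
    by (rule member_le_sum) auto
  then show "{\<alpha> :: 'm::finite \<Rightarrow> nat. sum \<alpha> UNIV < k} \<subseteq> (UNIV::'m set) \<rightarrow>\<^sub>E {..k}"
    by (fastforce intro: le_trans less_imp_le)
  show "finite ((UNIV::'m set) \<rightarrow>\<^sub>E {..k})"
    by (intro finite_PiE) auto
qed

lemma abs_monomial_le: "\<bar>\<Prod>i\<in>UNIV. (x $ i) ^ \<alpha> i\<bar> \<le> norm x ^ sum \<alpha> UNIV" for x :: "real ^ 'm"
proof -
  have "\<bar>\<Prod>i\<in>UNIV. (x $ i) ^ \<alpha> i\<bar> = (\<Prod>i\<in>UNIV. \<bar>x $ i\<bar> ^ \<alpha> i)"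
    by (simp add: abs_prod power_abs)
  also have "\<dots> \<le> (\<Prod>i\<in>UNIV. norm x ^ \<alpha> i)"
    by (intro prod_mono conjI power_mono component_le_norm_cart) auto
  finally show ?thesis by (simp add: power_sum)
qed

text \<open>In finite dimension unconditional summability is absolute: this holds for each real
  coordinate, and the norm is at most the sum of the absolute coordinates.\<close>

lemma abs_summable_on_cart:
  fixes f :: "'a \<Rightarrow> real ^ 'n"
  assumes "f summable_on A"
  shows "(\<lambda>x. norm (f x)) summable_on A"
proof -
  have "(\<lambda>x. \<bar>f x $ i\<bar>) summable_on A" for i
    using summable_on_iff_abs_summable_on_real[THEN iffD1, OF summable_on_bounded_linear[OF bounded_linear_vec_nth assms]]
    by simp
  then have sum: "(\<lambda>x. \<Sum>i\<in>J. \<bar>f x $ i\<bar>) summable_on A" for J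
    by (induction J rule: infinite_finite_induct) (auto intro: summable_on_add)
  show ?thesis
    by (rule Infinite_Sum.abs_summable_on_comparison_test'[OF sum[of UNIV]]) (rule norm_le_l1_cart)
qed

text \<open>At a diagonal point the monomial with exponent \<open>\<alpha>\<close> equals
  \<open>\<rho> ^ sum \<alpha> UNIV\<close>, so convergence there controls the coefficients by their
  degree alone.\<close>

lemma small_diagonal_point:
  assumes "r > 0"
  obtains \<rho> where "\<rho> > 0" "\<rho> < r" "norm ((\<chi> i. \<rho>) :: real ^ 'm) < r"
proof
  define \<rho> where "\<rho> = r / (2 * real CARD('m))"
  show "\<rho> > 0" using assms by (simp add: \<rho>_def)
  define p :: "real ^ 'm" where "p = (\<chi> i. \<rho>)"
  have "norm p \<le> (\<Sum>i\<in>UNIV. \<bar>p $ i\<bar>)" by (rule norm_le_l1_cart)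
  also have "\<dots> < r" using assms by (simp add: p_def \<rho>_def)
  finally show "norm ((\<chi> i. \<rho>) :: real ^ 'm) < r" by (simp add: p_def)
  then have "\<bar>p $ i\<bar> < r" for i
    using component_le_norm_cart[of p i] by (simp add: p_def)
  then show "\<rho> < r" by (simp add: p_def)
qed

text \<open>The series converges absolutely at a diagonal point with coordinates
  \<open>\<rho>\<close>. For \<open>norm x \<le> \<rho>\<close>, each term of degree at least
  \<open>K\<close> is at most \<open>(norm x / \<rho>) ^ K\<close> times the norm of the
  corresponding term there. The radius serves all \<open>K\<close>; only \<open>M\<close> depends on
  \<open>K\<close>.\<close>

lemma real_analytic_at_taylor:
  fixes f :: "real ^ 'm \<Rightarrow> real ^ 'n"
  assumes "real_analytic_at f 0"
  obtains h \<rho> where "\<rho> > 0" and "\<And>k. homogeneous k (h k)"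
    and "\<And>K. \<exists>M. \<forall>x. norm x \<le> \<rho> \<longrightarrow> norm (f x - (\<Sum>k<K. h k x)) \<le> M * norm x ^ K"
proof -
  from assms obtain a :: "('m \<Rightarrow> nat) \<Rightarrow> real ^ 'n" and r where r: "r > 0"
    and "\<forall>x\<in>ball 0 r. ((\<lambda>\<alpha>. (\<Prod>i\<in>UNIV. (x $ i - 0 $ i) ^ \<alpha> i) *\<^sub>R a \<alpha>) has_sum f x) UNIV"
    unfolding real_analytic_at_def by blast
  then have a: "((\<lambda>\<alpha>. (\<Prod>i\<in>UNIV. (x $ i) ^ \<alpha> i) *\<^sub>R a \<alpha>) has_sum f x) UNIV" if "x \<in> ball 0 r" for x
    using that by simp
  obtain \<rho> where \<rho>: "\<rho> > 0" and \<rho>r: "\<rho> < r" and "norm ((\<chi> i. \<rho>) :: real ^ 'm) < r"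
    using small_diagonal_point[OF r] .
  define p :: "real ^ 'm" where "p = (\<chi> i. \<rho>)"
  have "p \<in> ball 0 r" using \<open>norm ((\<chi> i. \<rho>) :: real ^ 'm) < r\<close> by (simp add: p_def)
  from a[OF this] have "(\<lambda>\<alpha>. (\<rho> ^ sum \<alpha> UNIV) *\<^sub>R a \<alpha>) summable_on UNIV"
    by (auto simp: p_def power_sum dest: has_sum_imp_summable)
  from abs_summable_on_cart[OF this]
  have summ: "(\<lambda>\<alpha>. \<rho> ^ sum \<alpha> UNIV * norm (a \<alpha>)) summable_on UNIV"
    using \<rho> by simp
  define h where "h k x = (\<Sum>\<alpha> | sum \<alpha> UNIV = k. (\<Prod>i\<in>UNIV. (x $ i) ^ \<alpha> i) *\<^sub>R a \<alpha>)" for k x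
  have "\<exists>M. \<forall>x. norm x \<le> \<rho> \<longrightarrow> norm (f x - (\<Sum>k<K. h k x)) \<le> M * norm x ^ K" for K
  proof -
    define I where "I = {\<alpha> :: 'm \<Rightarrow> nat. sum \<alpha> UNIV < K}"
    have fin: "finite I" unfolding I_def by (rule finite_multi_indices)
    have "(\<Sum>k<K. h k x) = (\<Sum>k<K. \<Sum>\<alpha>\<in>{\<alpha>\<in>I. sum \<alpha> UNIV = k}. (\<Prod>i\<in>UNIV. (x $ i) ^ \<alpha> i) *\<^sub>R a \<alpha>)" for x
      by (intro sum.cong) (auto simp: h_def I_def intro!: sum.cong)
    moreover have "(\<Sum>k<K. \<Sum>\<alpha>\<in>{\<alpha>\<in>I. sum \<alpha> UNIV = k}. (\<Prod>i\<in>UNIV. (x $ i) ^ \<alpha> i) *\<^sub>R a \<alpha>) = (\<Sum>\<alpha>\<in>I. (\<Prod>i\<in>UNIV. (x $ i) ^ \<alpha> i) *\<^sub>R a \<alpha>)" for x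
      by (rule sum.group) (use fin in \<open>auto simp: I_def\<close>)
    ultimately have split: "(\<Sum>k<K. h k x) = (\<Sum>\<alpha>\<in>I. (\<Prod>i\<in>UNIV. (x $ i) ^ \<alpha> i) *\<^sub>R a \<alpha>)" for x
      by simp
    define M0 where "M0 = infsum (\<lambda>\<alpha>. \<rho> ^ sum \<alpha> UNIV * norm (a \<alpha>)) (UNIV - I)"
    have M0: "((\<lambda>\<alpha>. \<rho> ^ sum \<alpha> UNIV * norm (a \<alpha>)) has_sum M0) (UNIV - I)"
      unfolding M0_def using summ by (intro has_sum_infsum summable_on_subset_banach[OF summ]) auto
    have "norm (f x - (\<Sum>k<K. h k x)) \<le> M0 / \<rho> ^ K * norm x ^ K" if x: "norm x \<le> \<rho>" for x :: "real ^ 'm"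
    proof -
      let ?m = "\<lambda>\<alpha>. (\<Prod>i\<in>UNIV. (x $ i) ^ \<alpha> i) *\<^sub>R a \<alpha>"
      have "(?m has_sum f x) UNIV" using x \<rho>r by (intro a) auto
      then have rest: "(?m has_sum (f x - (\<Sum>k<K. h k x))) (UNIV - I)"
        unfolding split using fin by (intro has_sum_Diff has_sum_finite) auto
      have bound: "((\<lambda>\<alpha>. (norm x / \<rho>) ^ K * (\<rho> ^ sum \<alpha> UNIV * norm (a \<alpha>))) has_sum (norm x / \<rho>) ^ K * M0) (UNIV - I)"
        by (intro has_sum_cmult_right M0)
      have le: "norm (?m \<alpha>) \<le> (norm x / \<rho>) ^ K * (\<rho> ^ sum \<alpha> UNIV * norm (a \<alpha>))" if "\<alpha> \<in> UNIV - I" for \<alpha>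
      proof -
        have K: "K \<le> sum \<alpha> UNIV" using that by (auto simp: I_def)
        have "norm (?m \<alpha>) \<le> norm x ^ sum \<alpha> UNIV * norm (a \<alpha>)"
          using abs_monomial_le[of x \<alpha>] by (simp add: mult_right_mono)
        also have "norm x ^ sum \<alpha> UNIV = (norm x / \<rho>) ^ sum \<alpha> UNIV * \<rho> ^ sum \<alpha> UNIV"
          using \<rho> by (simp add: power_divide)
        also have "\<dots> \<le> (norm x / \<rho>) ^ K * \<rho> ^ sum \<alpha> UNIV"
          using K x \<rho> by (intro mult_right_mono power_decreasing) auto
        finally show ?thesis by (simp add: mult_right_mono mult.assoc)
      qed
      have "(\<lambda>\<alpha>. norm (?m \<alpha>)) summable_on (UNIV - I)"
        using has_sum_imp_summable[OF bound] le by (rule Infinite_Sum.abs_summable_on_comparison_test')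
      then have "((\<lambda>\<alpha>. norm (?m \<alpha>)) has_sum infsum (\<lambda>\<alpha>. norm (?m \<alpha>)) (UNIV - I)) (UNIV - I)" by simp
      then have "norm (f x - (\<Sum>k<K. h k x)) \<le> infsum (\<lambda>\<alpha>. norm (?m \<alpha>)) (UNIV - I)"
        "infsum (\<lambda>\<alpha>. norm (?m \<alpha>)) (UNIV - I) \<le> (norm x / \<rho>) ^ K * M0"
        using norm_has_sum_bound[OF _ rest] has_sum_mono[OF _ bound] le by blast+
      then show ?thesis by (simp add: power_divide mult_ac)
    qed
    then show ?thesis by blast
  qed
  moreover have "homogeneous k (h k)" for k
    unfolding h_def by (intro homogeneous_sum homogeneous_monomial) auto
  ultimately show ?thesis using \<rho> that by blast
qed

section \<open>Curves on circles\<close>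

text \<open>Letting \<open>t\<close> tend to \<open>0\<close> from the right kills the constant
  coefficient; dividing by \<open>t\<close> then lowers the order of the estimate by one.\<close>

lemma coeff_eq_0_if_poly_small:
  fixes p :: "real poly"
  assumes "\<delta> > 0" and "\<And>t. 0 < t \<Longrightarrow> t \<le> \<delta> \<Longrightarrow> \<bar>poly p t\<bar> \<le> M * t ^ k" and "i < k"
  shows "coeff p i = 0"
  using assms(2,3)
proof (induction k arbitrary: p i)
  case (Suc k)
  have ev: "eventually (\<lambda>t. \<bar>poly p t\<bar> \<le> M * t ^ Suc k) (at_right 0)"
    using Suc.prems(1) \<open>\<delta> > 0\<close> by (auto simp: eventually_at_right_field intro!: exI[of _ \<delta>])
  have lim: "((\<lambda>t. M * t ^ Suc k) \<longlongrightarrow> 0) (at_right 0)"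
    by (auto intro!: tendsto_eq_intros)
  have "(poly p \<longlongrightarrow> 0) (at_right 0)"
    using ev by (intro Lim_null_comparison[OF _ lim]) simp
  moreover have "(poly p \<longlongrightarrow> poly p 0) (at_right 0)"
    by (intro tendsto_intros)
  ultimately have p0: "poly p 0 = 0"
    using tendsto_unique[of "at_right (0::real)"] by (simp add: trivial_limit_at_right_real)
  obtain a p' where p: "p = pCons a p'" by (cases p)
  with p0 have a: "a = 0" by simp
  have "\<bar>poly p' t\<bar> \<le> M * t ^ k" if "0 < t" "t \<le> \<delta>" for t
    using Suc.prems(1)[OF that] that by (simp add: p a abs_mult)
  from Suc.IH[OF this] show ?case
    using Suc.prems(2) by (cases i) (auto simp: p a)
qed simp

text \<open>Pairing the curve with a vector \<open>v\<close> orthogonal to \<open>S\<close> gives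
  zero, so the polynomial \<open>v \<bullet> (jet)\<close> is of order \<open>t ^ 5\<close> and its
  coefficients vanish. Taking the orthogonal complement twice returns \<open>S\<close>.\<close>

lemma jet_in_subspace:
  fixes y :: "real \<Rightarrow> 'a::euclidean_space"
  assumes S: "subspace S" and \<delta>: "\<delta> > 0"
    and exp: "\<And>t. \<bar>t\<bar> \<le> \<delta> \<Longrightarrow> norm (y t - (t *\<^sub>R A + t^2 *\<^sub>R B + t^3 *\<^sub>R C + t^4 *\<^sub>R D)) \<le> M * \<bar>t\<bar> ^ 5"
    and y: "\<And>t. \<bar>t\<bar> \<le> \<delta> \<Longrightarrow> y t \<in> S"
  shows "A \<in> S \<and> B \<in> S \<and> C \<in> S \<and> D \<in> S"
proof -
  have "v \<bullet> A = 0 \<and> v \<bullet> B = 0 \<and> v \<bullet> C = 0 \<and> v \<bullet> D = 0" if v: "v \<in> S\<^sup>\<bottom>" for v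
  proof -
    define p where "p = [:0, v \<bullet> A, v \<bullet> B, v \<bullet> C, v \<bullet> D:]"
    have "\<bar>poly p t\<bar> \<le> (norm v * M) * t ^ 5" if t: "0 < t" "t \<le> \<delta>" for t
    proof -
      have "v \<bullet> y t = 0"
        using v y[of t] t by (auto simp: orthogonal_comp_def orthogonal_def inner_commute)
      then have "poly p t = - (v \<bullet> (y t - (t *\<^sub>R A + t^2 *\<^sub>R B + t^3 *\<^sub>R C + t^4 *\<^sub>R D)))"
        by (simp add: p_def inner_simps algebra_simps power2_eq_square power3_eq_cube power4_eq_xxxx)
      then have "\<bar>poly p t\<bar> \<le> norm v * norm (y t - (t *\<^sub>R A + t^2 *\<^sub>R B + t^3 *\<^sub>R C + t^4 *\<^sub>R D))"
        using Cauchy_Schwarz_ineq2 by simp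
      also have "\<dots> \<le> norm v * (M * \<bar>t\<bar> ^ 5)"
        using exp[of t] t by (intro mult_left_mono) auto
      finally show ?thesis using t by simp
    qed
    from coeff_eq_0_if_poly_small[OF \<delta> this]
    have "coeff p i = 0" if "i < 5" for i using that by simp
    from this[of 1] this[of 2] this[of 3] this[of 4] show ?thesis
      by (simp add: p_def numeral_eq_Suc)
  qed
  then have "A \<in> (S\<^sup>\<bottom>)\<^sup>\<bottom>" "B \<in> (S\<^sup>\<bottom>)\<^sup>\<bottom>" "C \<in> (S\<^sup>\<bottom>)\<^sup>\<bottom>" "D \<in> (S\<^sup>\<bottom>)\<^sup>\<bottom>"
    by (auto simp: orthogonal_comp_def orthogonal_def)
  then show ?thesis using orthogonal_comp_self[OF S] by simp
qed

text \<open>The equation \<open>y \<bullet> y = 2 * (c \<bullet> y)\<close> describes the sphere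
  through \<open>0\<close> with centre \<open>c\<close>; the conclusions are its coefficients of
  orders one to four.\<close>

lemma jet_on_sphere:
  fixes y :: "real \<Rightarrow> 'a::euclidean_space"
  assumes \<delta>: "\<delta> > 0"
    and exp: "\<And>t. \<bar>t\<bar> \<le> \<delta> \<Longrightarrow> norm (y t - (t *\<^sub>R A + t^2 *\<^sub>R B + t^3 *\<^sub>R C + t^4 *\<^sub>R D)) \<le> M * \<bar>t\<bar> ^ 5"
    and y: "\<And>t. \<bar>t\<bar> \<le> \<delta> \<Longrightarrow> y t \<bullet> y t = 2 * (c \<bullet> y t)"
  shows "c \<bullet> A = 0" "2 * (c \<bullet> B) = A \<bullet> A" "2 * (c \<bullet> C) = 2 * (A \<bullet> B)"
    "2 * (c \<bullet> D) = B \<bullet> B + 2 * (A \<bullet> C)"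
proof -
  \<comment> \<open>The coefficients of degree five to eight make \<open>p\<close> agree exactly
    with the sphere equation of the truncated curve; only those below five are compared.\<close>
  define p where "p = [:0, - 2 * (c \<bullet> A), A \<bullet> A - 2 * (c \<bullet> B), 2 * (A \<bullet> B) - 2 * (c \<bullet> C),
      B \<bullet> B + 2 * (A \<bullet> C) - 2 * (c \<bullet> D), 2 * (A \<bullet> D) + 2 * (B \<bullet> C), C \<bullet> C + 2 * (B \<bullet> D), 2 * (C \<bullet> D), D \<bullet> D:]"
  define \<gamma> where "\<gamma> t = t *\<^sub>R A + t^2 *\<^sub>R B + t^3 *\<^sub>R C + t^4 *\<^sub>R D" for t
  define K where "K = norm A + norm B + norm C + norm D"
  have p: "poly p t = \<gamma> t \<bullet> \<gamma> t - 2 * (c \<bullet> \<gamma> t)" for t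
    by (simp add: p_def \<gamma>_def inner_simps inner_commute algebra_simps power2_eq_square power3_eq_cube power4_eq_xxxx)
  \<comment> \<open>The cap \<open>t \<le> 1\<close> allows \<open>\<gamma> t\<close> and the
    remainder to be bounded by constants.\<close>
  have "\<bar>poly p t\<bar> \<le> ((2 * K + M + 2 * norm c) * M) * t ^ 5" if t: "0 < t" "t \<le> min \<delta> 1" for t
  proof -
    define e where "e = y t - \<gamma> t"
    have e: "norm e \<le> M * t ^ 5" using exp[of t] t by (simp add: e_def \<gamma>_def)
    have tk: "t ^ k \<le> 1" for k using t by (simp add: power_le_one)
    have "norm (\<gamma> t) \<le> norm (t *\<^sub>R A) + norm (t^2 *\<^sub>R B) + norm (t^3 *\<^sub>R C) + norm (t^4 *\<^sub>R D)"
      unfolding \<gamma>_def by (meson norm_triangle_le order_refl add_right_mono norm_triangle_ineq order_trans)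
    also have "\<dots> \<le> K"
      unfolding K_def using t tk by (intro add_mono) (auto simp: mult_left_le_one_le)
    finally have g: "norm (\<gamma> t) \<le> K" .
    have M0: "0 \<le> M"
    proof -
      have "0 \<le> M * t ^ 5" using e norm_ge_zero order_trans by blast
      then show ?thesis using t by (simp add: zero_le_mult_iff)
    qed
    have eM: "norm e \<le> M"
      using e mult_left_mono[OF tk[of 5] M0] by simp
    \<comment> \<open>Substituting \<open>y t = \<gamma> t + e\<close> into the sphere equation
      isolates one factor \<open>e\<close>, which is of order \<open>t ^ 5\<close>.\<close>
    have "poly p t = - (e \<bullet> (2 *\<^sub>R \<gamma> t + e - 2 *\<^sub>R c))"
      using y[of t] t unfolding p by (simp add: e_def inner_simps inner_commute)
    then have "\<bar>poly p t\<bar> \<le> norm e * norm (2 *\<^sub>R \<gamma> t + e - 2 *\<^sub>R c)"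
      using Cauchy_Schwarz_ineq2 by simp
    also have "\<dots> \<le> (M * t ^ 5) * (2 * K + M + 2 * norm c)"
    proof (intro mult_mono e)
      have "norm (2 *\<^sub>R \<gamma> t + e - 2 *\<^sub>R c) \<le> norm (2 *\<^sub>R \<gamma> t) + norm e + norm (2 *\<^sub>R c)"
        by (meson norm_triangle_ineq4 norm_triangle_ineq order_trans add_right_mono)
      then show "norm (2 *\<^sub>R \<gamma> t + e - 2 *\<^sub>R c) \<le> 2 * K + M + 2 * norm c"
        using g eM by simp
      show "0 \<le> M * t ^ 5" using M0 t by simp
    qed auto
    finally show ?thesis by (simp add: mult_ac)
  qed
  from coeff_eq_0_if_poly_small[where \<delta> = "min \<delta> 1", OF _ this]
  have "coeff p i = 0" if "i < 5" for i using that \<delta> by simp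
  from this[of 1] this[of 2] this[of 3] this[of 4]
  show "c \<bullet> A = 0" "2 * (c \<bullet> B) = A \<bullet> A" "2 * (c \<bullet> C) = 2 * (A \<bullet> B)"
    "2 * (c \<bullet> D) = B \<bullet> B + 2 * (A \<bullet> C)"
    by (simp_all add: p_def numeral_eq_Suc)
qed

text \<open>The vectors \<open>A\<close> and \<open>B\<close> form a basis of the plane, so
  \<open>X = k *\<^sub>R A + l *\<^sub>R B\<close>. The wedge with \<open>A\<close> sees only
  \<open>l\<close>, and pairing with \<open>c\<close> gives
  \<open>m = l * (A \<bullet> A)\<close>.\<close>

lemma wedge_eq_in_plane:
  fixes A B X c :: "real ^ 'n"
  assumes S: "subspace S" "dim S = 2" and mem: "A \<in> S" "B \<in> S" "X \<in> S"
    and A: "A \<noteq> 0" and cA: "c \<bullet> A = 0" and cB: "2 * (c \<bullet> B) = A \<bullet> A" and cX: "2 * (c \<bullet> X) = m"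
  shows "(A \<bullet> A) * (X $ i * A $ j - X $ j * A $ i) = m * (B $ i * A $ j - B $ j * A $ i)"
proof -
  have cB0: "c \<bullet> B \<noteq> 0" using A cB by auto
  have B: "B \<notin> span {A}"
    using cA cB0 by (auto simp: span_singleton)
  have ind: "independent {A, B}"
    using A B by (metis independent_insert independent_empty insert_commute span_empty singletonD)
  have "A \<noteq> B" using cA cB0 by auto
  then have "S \<subseteq> span {A, B}"
    using S mem ind by (intro card_ge_dim_independent) auto
  then have "X \<in> span {A, B}" using mem by auto
  then obtain k where "X - k *\<^sub>R A \<in> span {B}"
    by (metis span_breakdown_eq)
  then obtain l where "X - k *\<^sub>R A = l *\<^sub>R B" by (auto simp: span_singleton)
  then have X: "X = k *\<^sub>R A + l *\<^sub>R B" by (simp add: algebra_simps)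
  have "m = l * (A \<bullet> A)"
    using cX cA by (simp add: X inner_simps flip: cB)
  then show ?thesis by (simp add: X algebra_simps)
qed

text \<open>A point would force \<open>A = 0\<close>. On a straight line \<open>B\<close>,
  \<open>C\<close>, \<open>D\<close> are multiples of \<open>A\<close>: both wedge identities are
  trivial, and \<open>B - l *\<^sub>R A\<close>, parallel and orthogonal to \<open>A\<close>,
  vanishes. On a round circle \<open>wedge_eq_in_plane\<close> applies with \<open>X = C\<close> and
  \<open>X = D\<close>, and the third claim is checked, for every \<open>t\<close>, against the
  equation of the circle.\<close>

lemma circle_jet:
  fixes y :: "real \<Rightarrow> real ^ 'n"
  assumes K: "is_circle K" and \<delta>: "\<delta> > 0"
    and exp: "\<And>t. \<bar>t\<bar> \<le> \<delta> \<Longrightarrow> norm (y t - (t *\<^sub>R A + t^2 *\<^sub>R B + t^3 *\<^sub>R C + t^4 *\<^sub>R D)) \<le> M * \<bar>t\<bar> ^ 5"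
    and y: "\<And>t. \<bar>t\<bar> \<le> \<delta> \<Longrightarrow> y t \<in> K" and A: "A \<noteq> 0"
  shows "(A \<bullet> A) * (C $ i * A $ j - C $ j * A $ i) = 2 * (A \<bullet> B) * (B $ i * A $ j - B $ j * A $ i)" (is ?third)
    and "(A \<bullet> A) * (D $ i * A $ j - D $ j * A $ i) =
      (B \<bullet> B + 2 * (A \<bullet> C)) * (B $ i * A $ j - B $ j * A $ i)" (is ?fourth)
    and "A \<bullet> (B - l *\<^sub>R A) = 0 \<Longrightarrow> (B - l *\<^sub>R A) \<bullet> (B - l *\<^sub>R A) = q * (A \<bullet> A) \<Longrightarrow>
      (t *\<^sub>R A + t\<^sup>2 *\<^sub>R (B - l *\<^sub>R A)) /\<^sub>R (1 + t\<^sup>2 * q) \<in> K" (is "_ \<Longrightarrow> _ \<Longrightarrow> ?osc")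
proof -
  have "y 0 = 0" using exp[of 0] \<delta> by simp
  then have K0: "0 \<in> K" using y[of 0] \<delta> by simp
  have "?third \<and> ?fourth \<and>
    (A \<bullet> (B - l *\<^sub>R A) = 0 \<longrightarrow> (B - l *\<^sub>R A) \<bullet> (B - l *\<^sub>R A) = q * (A \<bullet> A) \<longrightarrow> ?osc)"
    using K unfolding is_circle_def
  proof (elim disjE)
    assume "\<exists>p. K = {p}"
    with K0 have "K = {0}" by auto
    then have "A \<in> {0}"
      using jet_in_subspace[OF subspace_single_0 \<delta> exp] y by simp
    with A show ?thesis by simp
  next
    assume "straight_line K"
    then have S: "subspace K" and dimK: "dim K = 1"
      using K0 by (auto simp: straight_line_def subspace_affine aff_dim_subspace)
    have mem: "A \<in> K \<and> B \<in> K \<and> C \<in> K \<and> D \<in> K"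
      by (rule jet_in_subspace[OF S \<delta> exp y])
    have "K \<subseteq> span {A}"
      using A mem dimK by (intro card_ge_dim_independent) auto
    with mem have "B \<in> span {A}" "C \<in> span {A}" "D \<in> span {A}" by auto
    then obtain b c d where bcd: "B = b *\<^sub>R A" "C = c *\<^sub>R A" "D = d *\<^sub>R A"
      unfolding span_singleton by blast
    have "?osc" if "A \<bullet> (B - l *\<^sub>R A) = 0"
    proof -
      have "B - l *\<^sub>R A = 0" using that A by (simp add: bcd inner_simps)
      then show ?thesis using mem S by (simp add: subspace_scale)
    qed
    then show ?thesis by (simp add: bcd)
  next
    assume "round_circle K"
    then obtain S c r where S: "affine S" "aff_dim S = 2" "c \<in> S" "K = S \<inter> sphere c r"
      unfolding round_circle_def by blast
    have sub: "subspace S" using S K0 by (simp add: subspace_affine)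
    then have dim: "dim S = 2" using S(2) by (simp add: aff_dim_subspace)
    have Kiff: "x \<in> K \<longleftrightarrow> x \<in> S \<and> x \<bullet> x = 2 * (c \<bullet> x)" for x
    proof -
      \<comment> \<open>The circle passes through \<open>0\<close>.\<close>
      have "r = norm c" using K0 S by (simp add: dist_norm)
      then have "x \<in> sphere c r \<longleftrightarrow> (norm (c - x))\<^sup>2 = (norm c)\<^sup>2"
        by (simp add: dist_norm)
      also have "\<dots> \<longleftrightarrow> x \<bullet> x = 2 * (c \<bullet> x)"
        by (simp add: power2_norm_eq_inner inner_simps inner_commute)
      finally show ?thesis using S by simp
    qed
    have mem: "A \<in> S \<and> B \<in> S \<and> C \<in> S \<and> D \<in> S"
      using y Kiff by (intro jet_in_subspace[OF sub \<delta> exp]) auto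
    have sph: "y t \<bullet> y t = 2 * (c \<bullet> y t)" if "\<bar>t\<bar> \<le> \<delta>" for t
      using y[OF that] Kiff by blast
    note c = jet_on_sphere[OF \<delta> exp sph]
    have "?third" "?fourth"
      using mem by (auto intro!: wedge_eq_in_plane[OF sub dim _ _ _ A c(1,2)] c(3,4))
    moreover have ?osc if orth: "A \<bullet> (B - l *\<^sub>R A) = 0"
      and q: "(B - l *\<^sub>R A) \<bullet> (B - l *\<^sub>R A) = q * (A \<bullet> A)"
    proof -
      define B' where "B' = B - l *\<^sub>R A"
      define v where "v = t *\<^sub>R A + t\<^sup>2 *\<^sub>R B'"
      \<comment> \<open>The number \<open>q\<close> is a ratio of squared norms, so the denominator
        \<open>1 + t\<^sup>2 * q\<close> is positive.\<close>
      have "0 \<le> q * (A \<bullet> A)" using q inner_ge_zero by metis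
      moreover have "A \<bullet> A > 0" using A by simp
      ultimately have "q \<ge> 0" by (simp add: zero_le_mult_iff)
      then have pos: "1 + t\<^sup>2 * q > 0" by (simp add: add_pos_nonneg)
      have "v \<in> S" unfolding v_def B'_def using mem sub
        by (intro subspace_add subspace_scale subspace_diff) auto
      then have "v /\<^sub>R (1 + t\<^sup>2 * q) \<in> S" using sub by (simp add: subspace_scale)
      \<comment> \<open>The factor \<open>1 + t\<^sup>2 * q\<close> in \<open>v \<bullet> v\<close>
        is what the division corrects: afterwards both sides of the circle equation equal
        \<open>t\<^sup>2 * (A \<bullet> A) / (1 + t\<^sup>2 * q)\<close>.\<close>
      moreover have "v \<bullet> v = t\<^sup>2 * (A \<bullet> A) * (1 + t\<^sup>2 * q)"
        using orth q unfolding v_def B'_def[symmetric]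
        by (simp add: inner_simps inner_commute algebra_simps power2_eq_square)
      then have "(v /\<^sub>R (1 + t\<^sup>2 * q)) \<bullet> (v /\<^sub>R (1 + t\<^sup>2 * q)) = t\<^sup>2 * (A \<bullet> A) / (1 + t\<^sup>2 * q)"
        using pos by (simp add: inverse_eq_divide)
      moreover have "2 * (c \<bullet> v) = t\<^sup>2 * (A \<bullet> A)"
        using c(1,2) by (simp add: v_def B'_def inner_simps)
      then have "2 * (c \<bullet> (v /\<^sub>R (1 + t\<^sup>2 * q))) = t\<^sup>2 * (A \<bullet> A) / (1 + t\<^sup>2 * q)"
        by (simp add: inverse_eq_divide)
      ultimately show ?thesis
        unfolding Kiff by (simp add: v_def B'_def)
    qed
    ultimately show ?thesis by blast
  qed
  then show ?third ?fourth "A \<bullet> (B - l *\<^sub>R A) = 0 \<Longrightarrow> (B - l *\<^sub>R A) \<bullet> (B - l *\<^sub>R A) = q * (A \<bullet> A) \<Longrightarrow> ?osc"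
    by blast+
qed

section \<open>Analyticity of quadratic fractions\<close>

text \<open>Different indices \<open>j\<close> may carry the same monomial. Unconditional
  summability permits grouping by the fibres of \<open>\<beta>\<close>, and the sum of
  \<open>c\<close> over a fibre is the Taylor coefficient.\<close>

lemma real_analytic_at_0_I:
  fixes \<beta> :: "'j \<Rightarrow> 'm::finite \<Rightarrow> nat" and c :: "'j \<Rightarrow> real ^ 'n"
  assumes r: "r > 0"
    and sum: "\<And>x. norm x < r \<Longrightarrow> ((\<lambda>j. (\<Prod>i\<in>UNIV. (x $ i) ^ \<beta> j i) *\<^sub>R c j) has_sum f x) UNIV"
  shows "real_analytic_at f 0"
proof -
  obtain \<rho> where \<rho>: "\<rho> > 0" "norm ((\<chi> i. \<rho>) :: real ^ 'm) < r"
    using small_diagonal_point[OF r] .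
  define fib where "fib \<alpha> = {j. \<beta> j = \<alpha>}" for \<alpha>
  define a where "a \<alpha> = infsum c (fib \<alpha>)" for \<alpha>
  have a: "(c has_sum a \<alpha>) (fib \<alpha>)" for \<alpha>
  proof -
    \<comment> \<open>On one fibre the monomials take a single nonzero value at the diagonal point,
      which can be divided out.\<close>
    have "(\<lambda>j. \<rho> ^ sum (\<beta> j) UNIV *\<^sub>R c j) summable_on UNIV"
      using sum[OF \<rho>(2)] by (auto simp: power_sum dest: has_sum_imp_summable)
    then have "(\<lambda>j. \<rho> ^ sum (\<beta> j) UNIV *\<^sub>R c j) summable_on fib \<alpha>"
      by (rule summable_on_subset_banach) auto
    then have "(\<lambda>j. \<rho> ^ sum \<alpha> UNIV *\<^sub>R c j) summable_on fib \<alpha>"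
      by (rule summable_on_cong[THEN iffD1, rotated]) (simp add: fib_def)
    from summable_on_bounded_linear[OF bounded_linear_scaleR_right this, of "inverse (\<rho> ^ sum \<alpha> UNIV)"]
    have "c summable_on fib \<alpha>" using \<rho> by simp
    then show ?thesis unfolding a_def by simp
  qed
  have "((\<lambda>\<alpha>. (\<Prod>i\<in>UNIV. (x $ i) ^ \<alpha> i) *\<^sub>R a \<alpha>) has_sum f x) UNIV" if "norm x < r" for x :: "real ^ 'm"
  proof -
    let ?F = "\<lambda>(\<alpha>, j). (\<Prod>i\<in>UNIV. (x $ i) ^ \<alpha> i) *\<^sub>R c j"
    have "bij_betw (\<lambda>j. (\<beta> j, j)) UNIV (Sigma UNIV fib)"
      by (rule bij_betwI[where g = snd]) (auto simp: fib_def)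
    then have "(?F has_sum f x) (Sigma UNIV fib)"
      using sum[OF that] by (subst has_sum_reindex_bij_betw[symmetric]) auto
    then show ?thesis
      by (rule has_sum_SigmaD) (use a in \<open>auto intro!: has_sum_bounded_linear[OF bounded_linear_scaleR_right]\<close>)
  qed
  with r show ?thesis
    unfolding real_analytic_at_def by (intro exI[of _ a] exI[of _ r]) auto
qed

lemma real_analytic_at_0_add:
  fixes f g :: "real ^ 'm \<Rightarrow> real ^ 'n"
  assumes "real_analytic_at f 0" "real_analytic_at g 0"
  shows "real_analytic_at (\<lambda>x. f x + g x) 0"
proof -
  from assms(1) obtain a r where a: "r > 0"
    "\<forall>x\<in>ball 0 r. ((\<lambda>\<alpha>. (\<Prod>i\<in>UNIV. (x $ i - 0 $ i) ^ \<alpha> i) *\<^sub>R a \<alpha>) has_sum f x) UNIV"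
    unfolding real_analytic_at_def by blast
  from assms(2) obtain b s where b: "s > 0"
    "\<forall>x\<in>ball 0 s. ((\<lambda>\<alpha>. (\<Prod>i\<in>UNIV. (x $ i - 0 $ i) ^ \<alpha> i) *\<^sub>R b \<alpha>) has_sum g x) UNIV"
    unfolding real_analytic_at_def by blast
  show ?thesis unfolding real_analytic_at_def
    using a b by (intro exI[of _ "\<lambda>\<alpha>. a \<alpha> + b \<alpha>"] exI[of _ "min r s"])
      (auto simp: scaleR_add_right intro!: has_sum_add)
qed

lemma real_analytic_at_0_sum:
  fixes f :: "'a \<Rightarrow> real ^ 'm \<Rightarrow> real ^ 'n"
  assumes "\<And>a. a \<in> S \<Longrightarrow> real_analytic_at (f a) 0"
  shows "real_analytic_at (\<lambda>x. \<Sum>a\<in>S. f a x) 0"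
proof -
  have "real_analytic_at (\<lambda>x :: real ^ 'm. 0 :: real ^ 'n) 0"
    unfolding real_analytic_at_def by (intro exI[of _ "\<lambda>_. 0"] exI[of _ 1]) auto
  then show ?thesis
    using assms by (induction S rule: infinite_finite_induct) (auto intro: real_analytic_at_0_add)
qed

section \<open>Geometric series as sums over words\<close>

lemma finite_lists_of_length: "finite {L :: 'p::finite list. length L = k}"
  using finite_lists_length_eq[of "UNIV :: 'p set" k] by simp

text \<open>The power is multiplied out without collecting terms: a word records the summand chosen
  from each factor.\<close>

lemma sum_prod_lists_of_length:
  fixes y :: "'p::finite \<Rightarrow> 'a::comm_semiring_1"
  shows "(\<Sum>L | length L = k. \<Prod>p\<leftarrow>L. y p) = (\<Sum>p\<in>UNIV. y p) ^ k"
proof (induction k)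
  case (Suc k)
  have "{L :: 'p list. length L = Suc k} = (\<lambda>(p, L). p # L) ` (UNIV \<times> {L. length L = k})"
    by (auto simp: length_Suc_conv)
  moreover have "inj_on (\<lambda>(p :: 'p, L). p # L) (UNIV \<times> {L. length L = k})"
    by (auto simp: inj_on_def)
  ultimately have "(\<Sum>L | length L = Suc k. \<Prod>p\<leftarrow>L. y p) =
      (\<Sum>(p, L)\<in>UNIV \<times> {L. length L = k}. y p * (\<Prod>p\<leftarrow>L. y p))"
    by (simp add: sum.reindex case_prod_unfold)
  also have "\<dots> = (\<Sum>p\<in>UNIV. y p) * (\<Sum>L | length L = k. \<Prod>p\<leftarrow>L. y p)"
    by (simp add: sum.cartesian_product[symmetric] sum_product)
  finally show ?case by (simp add: Suc.IH)
qed simp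

text \<open>The geometric series of \<open>\<Sum>p. y p\<close>, fully expanded into words in the letters \<open>p\<close>.\<close>
lemma has_sum_prod_lists:
  fixes y :: "'p::finite \<Rightarrow> real"
  assumes "(\<Sum>p\<in>UNIV. \<bar>y p\<bar>) < 1"
  shows "((\<lambda>L. \<Prod>p\<leftarrow>L. y p) has_sum inverse (1 - (\<Sum>p\<in>UNIV. y p))) UNIV"
proof -
  let ?W = "\<lambda>k. {L :: 'p list. length L = k}"
  have geo: "((\<lambda>k. s ^ k) has_sum inverse (1 - s)) UNIV" if "\<bar>s\<bar> < 1" for s :: real
    using that by (intro norm_summable_imp_has_sum)
      (auto simp: power_abs inverse_eq_divide intro!: geometric_sums summable_geometric)
  have inner: "((\<lambda>L. \<Prod>p\<leftarrow>L. z p) has_sum (\<Sum>p\<in>UNIV. z p) ^ k) (?W k)" for z :: "'p \<Rightarrow> real" and k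
    by (intro has_sum_finiteI) (auto simp: finite_lists_of_length sum_prod_lists_of_length)
  have abs_y: "\<bar>\<Prod>p\<leftarrow>L. y p\<bar> = (\<Prod>p\<leftarrow>L. \<bar>y p\<bar>)" for L
    by (induction L) (auto simp: abs_mult)
  \<comment> \<open>The same expansion for absolute values gives a convergent geometric series,
    which justifies summing first over words of fixed length.\<close>
  have "(\<lambda>(k, L). \<Prod>p\<leftarrow>L. \<bar>y p\<bar>) summable_on Sigma UNIV ?W"
  proof (rule summable_on_SigmaI)
    show "(\<lambda>k. (\<Sum>p\<in>UNIV. \<bar>y p\<bar>) ^ k) summable_on UNIV"
      using geo[of "\<Sum>p\<in>UNIV. \<bar>y p\<bar>"] assms by (auto simp: sum_nonneg dest: has_sum_imp_summable)
  qed (use inner[of "\<lambda>p. \<bar>y p\<bar>"] in \<open>auto simp flip: abs_y\<close>)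
  then have "(\<lambda>(k, L). \<Prod>p\<leftarrow>L. y p) summable_on Sigma UNIV ?W"
    by (subst summable_on_iff_abs_summable_on_real) (simp add: case_prod_unfold abs_y)
  moreover have "\<bar>\<Sum>p\<in>UNIV. y p\<bar> < 1"
    using sum_abs[of y UNIV] assms by linarith
  ultimately have "((\<lambda>(k, L). \<Prod>p\<leftarrow>L. y p) has_sum inverse (1 - (\<Sum>p\<in>UNIV. y p))) (Sigma UNIV ?W)"
    by (intro has_sum_SigmaI[OF _ geo]) (use inner in auto)
  moreover have "bij_betw (\<lambda>L :: 'p list. (length L, L)) UNIV (Sigma UNIV ?W)"
    by (rule bij_betwI[where g = snd]) auto
  ultimately show ?thesis
    using has_sum_reindex_bij_betw[of "\<lambda>L :: 'p list. (length L, L)" UNIV "Sigma UNIV ?W" "\<lambda>(k, L). \<Prod>p\<leftarrow>L. y p"] by simp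
qed

section \<open>Power series of quadratic fractions\<close>

lemma prod_power_indicator:
  fixes y :: "'m::finite \<Rightarrow> 'a::comm_semiring_1"
  shows "(\<Prod>i\<in>UNIV. y i ^ (if i = k then 1 else 0)) = y k"
proof -
  have "(\<Prod>i\<in>UNIV. y i ^ (if i = k then 1 else 0)) = (\<Prod>i\<in>UNIV. if i = k then y i else 1)"
    by (rule prod.cong) auto
  then show ?thesis by simp
qed

text \<open>The reciprocal is a geometric series in the negated quadratic form. Expanded into words
  whose letters are pairs of coordinates, it contributes one monomial per word, as
  \<open>real_analytic_at_0_I\<close> requires.\<close>

lemma real_analytic_at_0_monomial_divide:
  fixes \<gamma> :: "'m::finite \<Rightarrow> nat" and c :: "'m \<times> 'm \<Rightarrow> real" and v :: "real ^ 'n"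
  shows "real_analytic_at (\<lambda>x. ((\<Prod>i\<in>UNIV. (x $ i) ^ \<gamma> i) *\<^sub>R v) /\<^sub>R (1 + (\<Sum>p\<in>UNIV. c p * (x $ fst p * x $ snd p)))) 0"
proof -
  define e :: "'m \<Rightarrow> 'm \<Rightarrow> nat" where "e k i = (if i = k then 1 else 0)" for k i
  \<comment> \<open>Each letter of the word raises the exponents of its two coordinates by one,
    counted twice if they coincide.\<close>
  define \<beta> where "\<beta> L i = \<gamma> i + (\<Sum>p\<leftarrow>L. e (fst p) i + e (snd p) i)" for L i
  define d where "d L = (\<Prod>p\<leftarrow>L. - c p) *\<^sub>R v" for L
  define M where "M = (\<Sum>p\<in>UNIV. \<bar>c p\<bar>)"
  have M: "M \<ge> 0" unfolding M_def by (intro sum_nonneg) auto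
  have pe: "(\<Prod>i\<in>UNIV. (x $ i) ^ e k i) = x $ k" for x :: "real ^ 'm" and k
    by (simp add: e_def prod_power_indicator)
  have word: "(\<Prod>i\<in>UNIV. (x $ i) ^ \<beta> L i) *\<^sub>R d L =
      (\<Prod>p\<leftarrow>L. - c p * (x $ fst p * x $ snd p)) *\<^sub>R ((\<Prod>i\<in>UNIV. (x $ i) ^ \<gamma> i) *\<^sub>R v)" for x :: "real ^ 'm" and L
    by (induction L) (simp_all add: \<beta>_def d_def power_add prod.distrib pe mult_ac)
  show ?thesis
  proof (rule real_analytic_at_0_I)
    \<comment> \<open>The bound \<open>1\<close> gives
      \<open>\<bar>x $ i * x $ j\<bar> \<le> norm x\<close>; the bound \<open>1 / (M + 1)\<close>,
      meaningful also for \<open>M = 0\<close>, then makes the ratio of the geometric series less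
      than one.\<close>
    show "0 < min 1 (1 / (M + 1))" using M by auto
    fix x :: "real ^ 'm" assume x: "norm x < min 1 (1 / (M + 1))"
    have "(\<Sum>p\<in>UNIV. \<bar>- c p * (x $ fst p * x $ snd p)\<bar>) \<le> (\<Sum>p\<in>UNIV. \<bar>c p\<bar> * norm x)"
    proof (rule sum_mono)
      fix p :: "'m \<times> 'm"
      have "\<bar>x $ fst p * x $ snd p\<bar> \<le> norm x * 1"
        unfolding abs_mult using x component_le_norm_cart[of x]
        by (intro mult_mono) (auto intro: order_trans[OF component_le_norm_cart])
      then show "\<bar>- c p * (x $ fst p * x $ snd p)\<bar> \<le> \<bar>c p\<bar> * norm x"
        by (simp add: abs_mult mult_left_mono)
    qed
    also have "\<dots> = M * norm x" by (simp add: M_def sum_distrib_right)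
    also have "\<dots> \<le> (M + 1) * norm x" by (intro mult_right_mono) auto
    also have "\<dots> < 1" using x M by (simp add: field_simps)
    finally have "((\<lambda>L. \<Prod>p\<leftarrow>L. - c p * (x $ fst p * x $ snd p)) has_sum
       inverse (1 - (\<Sum>p\<in>UNIV. - c p * (x $ fst p * x $ snd p)))) UNIV"
      by (rule has_sum_prod_lists)
    then have "((\<lambda>L. \<Prod>p\<leftarrow>L. - c p * (x $ fst p * x $ snd p)) has_sum
       inverse (1 + (\<Sum>p\<in>UNIV. c p * (x $ fst p * x $ snd p)))) UNIV"
      by (simp add: sum_negf)
    from has_sum_bounded_linear[OF bounded_linear_scaleR_left this]
    show "((\<lambda>L. (\<Prod>i\<in>UNIV. (x $ i) ^ \<beta> L i) *\<^sub>R d L) has_sum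
       ((\<Prod>i\<in>UNIV. (x $ i) ^ \<gamma> i) *\<^sub>R v) /\<^sub>R (1 + (\<Sum>p\<in>UNIV. c p * (x $ fst p * x $ snd p)))) UNIV"
      unfolding word .
  qed
qed

lemma bilinear_cart_expansion:
  fixes b :: "real ^ 'm \<Rightarrow> real ^ 'm \<Rightarrow> 'b::real_vector"
  assumes "bilinear b"
  shows "b x x = (\<Sum>p\<in>UNIV. (x $ fst p * x $ snd p) *\<^sub>R b (axis (fst p) 1) (axis (snd p) 1))"
proof -
  have "b x x = b (\<Sum>i\<in>UNIV. x $ i *\<^sub>R axis i 1) (\<Sum>i\<in>UNIV. x $ i *\<^sub>R axis i 1)"
    using basis_expansion[of x] by (simp add: scalar_mult_eq_scaleR)
  also have "\<dots> = (\<Sum>(i, j)\<in>UNIV \<times> UNIV. b (x $ i *\<^sub>R axis i 1) (x $ j *\<^sub>R axis j 1))"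
    by (rule bilinear_sum[OF assms])
  also have "\<dots> = (\<Sum>p\<in>UNIV. (x $ fst p * x $ snd p) *\<^sub>R b (axis (fst p) 1) (axis (snd p) 1))"
    by (simp add: case_prod_unfold bilinear_lmul[OF assms] bilinear_rmul[OF assms] mult.commute)
  finally show ?thesis .
qed

lemma real_analytic_at_0_quadratic_divide:
  fixes A :: "real ^ 'm \<Rightarrow> real ^ 'n"
  assumes A: "linear A" and b: "bilinear b" and g: "bilinear g"
  shows "real_analytic_at (\<lambda>x. (A x + b x x) /\<^sub>R (1 + g x x)) 0"
proof -
  define e :: "'m \<Rightarrow> 'm \<Rightarrow> nat" where "e k i = (if i = k then 1 else 0)" for k i
  have pe: "(\<Prod>i\<in>UNIV. (x $ i) ^ e k i) = x $ k" for x :: "real ^ 'm" and k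
    by (simp add: e_def prod_power_indicator)
  have Ax: "A x = (\<Sum>i\<in>UNIV. x $ i *\<^sub>R A (axis i 1))" for x
  proof -
    have "A x = A (\<Sum>i\<in>UNIV. x $ i *\<^sub>R axis i 1)"
      using basis_expansion[of x] by (simp add: scalar_mult_eq_scaleR)
    also have "\<dots> = (\<Sum>i\<in>UNIV. x $ i *\<^sub>R A (axis i 1))"
      by (simp add: linear_sum[OF A] linear_scale[OF A])
    finally show ?thesis .
  qed
  define c where "c p = g (axis (fst p) 1) (axis (snd p) 1)" for p :: "'m \<times> 'm"
  have gx: "g x x = (\<Sum>p\<in>UNIV. c p * (x $ fst p * x $ snd p))" for x
    by (simp add: bilinear_cart_expansion[OF g] c_def mult.commute)
  have eq: "(A x + b x x) /\<^sub>R (1 + g x x) =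
      (\<Sum>i\<in>UNIV. ((\<Prod>k\<in>UNIV. (x $ k) ^ e i k) *\<^sub>R A (axis i 1)) /\<^sub>R (1 + (\<Sum>p\<in>UNIV. c p * (x $ fst p * x $ snd p)))) +
      (\<Sum>q\<in>UNIV. ((\<Prod>k\<in>UNIV. (x $ k) ^ (e (fst q) k + e (snd q) k)) *\<^sub>R b (axis (fst q) 1) (axis (snd q) 1)) /\<^sub>R
        (1 + (\<Sum>p\<in>UNIV. c p * (x $ fst p * x $ snd p))))" for x
    unfolding gx[of x] Ax[of x] bilinear_cart_expansion[OF b, of x]
    by (simp add: power_add prod.distrib pe scaleR_add_right scaleR_sum_right)
  show ?thesis unfolding eq
    by (intro real_analytic_at_0_add real_analytic_at_0_sum real_analytic_at_0_monomial_divide)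
qed

section \<open>Rounding maps\<close>

lemma vector_line_iff_span: "vector_line l \<longleftrightarrow> (\<exists>x. x \<noteq> 0 \<and> l = span {x})"
proof
  assume "vector_line l"
  then have l: "subspace l" "dim l = 1"
    by (auto simp: vector_line_def straight_line_def subspace_affine aff_dim_subspace)
  then obtain B where B: "B \<subseteq> l" "independent B" "l \<subseteq> span B" "card B = 1"
    using basis_exists[of l] by metis
  then obtain x where x: "B = {x}" by (auto simp: card_1_singleton_iff)
  then have "x \<noteq> 0" using B(2) by (auto simp: dependent_zero)
  moreover have "l = span {x}"
    using B l x by (metis span_minimal subset_antisym)
  ultimately show "\<exists>x. x \<noteq> 0 \<and> l = span {x}" by blast
next
  assume "\<exists>x. x \<noteq> 0 \<and> l = span {x}"
  then obtain x where x: "x \<noteq> 0" "l = span {x}" by blast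
  then have "subspace l" by simp
  moreover have "dim l = 1" using x dim_eq_card_independent[of "{x}"] by simp
  ultimately show "vector_line l"
    by (auto simp: vector_line_def straight_line_def subspace_affine aff_dim_subspace)
qed

lemma germ_image_in_spanD:
  assumes "germ_image_in f (span {x}) C"
  obtains \<delta> where "\<delta> > 0" "\<And>t. \<bar>t\<bar> \<le> \<delta> \<Longrightarrow> f (t *\<^sub>R x) \<in> C"
proof -
  from assms obtain U where U: "open U" "0 \<in> U" "f ` (span {x} \<inter> U) \<subseteq> C"
    unfolding germ_image_in_def by blast
  then obtain r where r: "r > 0" "ball 0 r \<subseteq> U"
    using open_contains_ball by blast
  show ?thesis
  proof
    \<comment> \<open>The summand \<open>1\<close> keeps the denominator positive and makes the
      resulting bound on \<open>t *\<^sub>R x\<close> strict.\<close>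
    show "r / (norm x + 1) > 0" using r by (simp add: add_nonneg_pos)
    fix t assume "\<bar>t\<bar> \<le> r / (norm x + 1)"
    then have "\<bar>t\<bar> * (norm x + 1) \<le> r"
      by (simp add: pos_le_divide_eq add_nonneg_pos)
    then have "norm (t *\<^sub>R x) < r"
      by (cases "t = 0") (use r in \<open>auto simp: algebra_simps\<close>)
    then show "f (t *\<^sub>R x) \<in> C"
      using U r by (intro subsetD[OF U(3)] imageI) (auto simp: span_mul span_base)
  qed
qed

text \<open>Continuity carries identities from generic points to exceptional ones, approached along
  the direction \<open>v\<close>.\<close>

lemma eq_0_at_limit_of_zeros:
  fixes f :: "'a::real_normed_vector \<Rightarrow> real"
  assumes "continuous_on UNIV f" and "\<And>\<epsilon>. \<epsilon> \<noteq> 0 \<Longrightarrow> f (x + \<epsilon> *\<^sub>R v) = 0"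
  shows "f x = 0"
proof -
  have "continuous_on UNIV (\<lambda>\<epsilon>. f (x + \<epsilon> *\<^sub>R v))"
    by (rule continuous_on_compose2[OF assms(1)]) (auto intro!: continuous_intros)
  then have "((\<lambda>\<epsilon>. f (x + \<epsilon> *\<^sub>R v)) \<longlongrightarrow> f (x + 0 *\<^sub>R v)) (at 0)"
    unfolding continuous_on_def by (rule bspec) simp
  moreover have "((\<lambda>\<epsilon>. f (x + \<epsilon> *\<^sub>R v)) \<longlongrightarrow> 0) (at 0)"
    by (rule tendsto_eventually) (simp add: eventually_at_filter assms(2))
  ultimately show ?thesis
    using LIM_unique by fastforce
qed

text \<open>
  The quotients are read off from long division by \<open>\<bar>A x\<bar>\<^sup>2\<close> in the variable \<open>u\<close> of \<open>x = u e + w\<close>.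
\<close>
lemma divisibility_by_norm_form:
  fixes A C D :: "real ^ 'm \<Rightarrow> real ^ 'n" and b :: "real ^ 'm \<Rightarrow> real ^ 'm \<Rightarrow> real ^ 'n"
  assumes A: "linear A" and b: "bilinear b" and sym: "\<And>x y. b x y = b y x"
    and C: "homogeneous 3 C" and D: "homogeneous 4 D"
    and e: "A e \<bullet> A e = 1" and w0: "A e \<bullet> A w0 = 0" "A w0 \<noteq> 0"
    and third: "\<And>x i j. (A x \<bullet> A x) * (C x $ i * A x $ j - C x $ j * A x $ i) =
        2 * (A x \<bullet> b x x) * (b x x $ i * A x $ j - b x x $ j * A x $ i)"
    and fourth: "\<And>x i j. (A x \<bullet> A x) * (D x $ i * A x $ j - D x $ j * A x $ i) =
        (b x x \<bullet> b x x + 2 * (A x \<bullet> C x)) * (b x x $ i * A x $ j - b x x $ j * A x $ i)"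
  obtains l g where "linear l" "bilinear g" "\<And>x. A x \<bullet> b x x = l x * (A x \<bullet> A x)"
    "\<And>x. b x x \<bullet> b x x = g x x * (A x \<bullet> A x)"
proof -
  \<comment> \<open>Since \<open>A e\<close> is a unit vector, \<open>u x\<close> is the component
    of \<open>A x\<close> along it, and \<open>w x\<close> is chosen so that \<open>A (w x)\<close>
    is orthogonal to \<open>A e\<close>.\<close>
  define u where "u x = A e \<bullet> A x" for x
  define w where "w x = x - u x *\<^sub>R e" for x
  \<comment> \<open>These are the quotients of \<open>divisibility_on_line\<close> for
    \<open>p = A e\<close>, \<open>q = A (w x)\<close>, \<open>b0 = b (w x) (w x)\<close>,
    \<open>b1 = 2 *\<^sub>R b e (w x)\<close> and \<open>b2 = b e e\<close>, with \<open>g\<close>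
    polarised to a bilinear form.\<close>
  define l where "l x = u x * (A e \<bullet> b e e) + (A (w x) \<bullet> b e e + A e \<bullet> (2 *\<^sub>R b e (w x)))" for x
  define g where "g x y = u x * u y * (b e e \<bullet> b e e) + u x * (2 * ((2 *\<^sub>R b e (w y)) \<bullet> b e e)) +
      ((2 *\<^sub>R b e (w x)) \<bullet> (2 *\<^sub>R b e (w y)) + 2 * (b (w x) (w y) \<bullet> b e e) - (A (w x) \<bullet> A (w y)) * (b e e \<bullet> b e e))" for x y
  have u: "linear u" unfolding u_def
    by (intro linearI) (simp_all add: linear_add[OF A] linear_scale[OF A] inner_simps)
  have w: "linear w" unfolding w_def
    by (intro linearI) (simp_all add: linear_add[OF u] linear_scale[OF u] algebra_simps)
  note lin = linear_add[OF A] linear_scale[OF A] linear_add[OF u] linear_scale[OF u]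
    linear_add[OF w] linear_scale[OF w] bilinear_ladd[OF b] bilinear_radd[OF b]
    bilinear_lmul[OF b] bilinear_rmul[OF b] inner_add_left inner_add_right
  have l: "linear l" unfolding l_def
    by (intro linearI) (simp_all add: lin algebra_simps)
  have g: "bilinear g" unfolding bilinear_def g_def
    by (intro conjI allI linearI) (simp_all add: lin algebra_simps)
  have Aw: "A e \<bullet> A (w x) = 0" for x
    by (simp add: w_def u_def linear_diff[OF A] linear_scale[OF A] inner_simps e)
  have generic: "A x \<bullet> b x x = l x * (A x \<bullet> A x) \<and> b x x \<bullet> b x x = g x x * (A x \<bullet> A x)"
    if "A (w x) \<noteq> 0" for x
  proof -
    let ?x = "\<lambda>t. t *\<^sub>R e + w x"
    have Ax: "A (?x t) = t *\<^sub>R A e + A (w x)" for t by (simp add: lin)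
    have bx: "b (?x t) (?x t) = b (w x) (w x) + t *\<^sub>R (2 *\<^sub>R b e (w x)) + t\<^sup>2 *\<^sub>R b e e" for t
      using sym[of "w x" e] by (simp add: lin power2_eq_square scaleR_2 algebra_simps)
    have x: "?x (u x) = x" by (simp add: w_def)
    note div = divisibility_on_line[OF e Aw that, where u = "u x" and B = "\<lambda>t. b (?x t) (?x t)" and C = "\<lambda>t. C (?x t)"
        and D = "\<lambda>t. D (?x t)", folded Ax, OF bx homogeneous_poly_on_line[OF C] homogeneous_poly_on_line[OF D] third fourth]
    from div show ?thesis unfolding x l_def g_def by (simp add: power2_eq_square)
  qed
  have "A x \<bullet> b x x - l x * (A x \<bullet> A x) = 0 \<and> b x x \<bullet> b x x - g x x * (A x \<bullet> A x) = 0" for x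
  proof (cases "A (w x) = 0")
    case True
    \<comment> \<open>Here the norm form on the line degenerates to \<open>u\<^sup>2\<close>, whose
      root is real. Moving by \<open>t *\<^sub>R w0\<close> changes \<open>A (w x)\<close> by
      \<open>t *\<^sub>R A w0\<close> and so reaches generic points.\<close>
    have "w w0 = w0" using w0 by (simp add: w_def u_def)
    then have "A (w (x + t *\<^sub>R w0)) \<noteq> 0" if "t \<noteq> 0" for t
      using True that w0 by (simp add: lin)
    note gen = generic[OF this]
    have cA: "continuous_on UNIV A" and cl: "continuous_on UNIV l"
      using A l by (simp_all add: linear_continuous_on linear_linear)
    have cb: "continuous_on UNIV (\<lambda>x. b x x)" and cg: "continuous_on UNIV (\<lambda>x. g x x)"
      using bounded_bilinear.continuous_on[OF b[unfolded bilinear_conv_bounded_bilinear] continuous_on_id continuous_on_id]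
        bounded_bilinear.continuous_on[OF g[unfolded bilinear_conv_bounded_bilinear] continuous_on_id continuous_on_id]
      by blast+
    have cont: "continuous_on UNIV (\<lambda>x. A x \<bullet> b x x - l x * (A x \<bullet> A x))"
      "continuous_on UNIV (\<lambda>x. b x x \<bullet> b x x - g x x * (A x \<bullet> A x))"
      by (intro continuous_intros cA cl cb cg)+
    show ?thesis
    proof (intro conjI)
      show "A x \<bullet> b x x - l x * (A x \<bullet> A x) = 0"
        by (rule eq_0_at_limit_of_zeros[OF cont(1), where v = w0]) (use gen in simp)
      show "b x x \<bullet> b x x - g x x * (A x \<bullet> A x) = 0"
        by (rule eq_0_at_limit_of_zeros[OF cont(2), where v = w0]) (use gen in simp)
    qed
  qed (use generic[of x] in simp)
  then show ?thesis using that[OF l g] by simp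
qed

section \<open>Quadratic polynomials and first differentials\<close>

lemma quadratic_polynomial_bilinear:
  assumes f: "linear f" and g: "bilinear g"
  shows "quadratic_polynomial (\<lambda>x. f x + g x x + c)"
proof -
  have fx: "f x = (\<Sum>i\<in>UNIV. f (axis i 1) * x $ i)" for x
  proof -
    have "f x = f (\<Sum>i\<in>UNIV. x $ i *\<^sub>R axis i 1)"
      using basis_expansion[of x] by (simp add: scalar_mult_eq_scaleR)
    also have "\<dots> = (\<Sum>i\<in>UNIV. f (axis i 1) * x $ i)"
      by (simp add: linear_sum[OF f] linear_scale[OF f] mult.commute)
    finally show ?thesis .
  qed
  have gx: "g x x = (\<Sum>i\<in>UNIV. \<Sum>j\<in>UNIV. g (axis i 1) (axis j 1) * x $ i * x $ j)" for x
    unfolding bilinear_cart_expansion[OF g, of x]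
    by (simp add: sum.cartesian_product case_prod_unfold mult_ac)
  show ?thesis unfolding quadratic_polynomial_def
  proof (intro exI allI)
    fix x
    show "f x + g x x + c = (\<Sum>i\<in>UNIV. \<Sum>j\<in>UNIV. g (axis i 1) (axis j 1) * x $ i * x $ j) +
        (\<Sum>i\<in>UNIV. f (axis i 1) * x $ i) + c"
      unfolding fx[of x] gx[of x] by simp
  qed
qed

text \<open>Quadratic terms are invisible to first order, so the constructed fraction inherits the
  differential of the rounding, and with it the rank.\<close>

lemma has_derivative_quadratic_divide:
  fixes A :: "real ^ 'm \<Rightarrow> real ^ 'n"
  assumes A: "linear A" and b: "bilinear b" and g: "bilinear g"
  shows "((\<lambda>x. (A x + b x x) /\<^sub>R (1 + g x x)) has_derivative A) (at 0)"
proof -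
  interpret b: bounded_bilinear b using b by (simp add: bilinear_conv_bounded_bilinear)
  interpret g: bounded_bilinear g using g by (simp add: bilinear_conv_bounded_bilinear)
  have A': "bounded_linear A" using A by (simp add: linear_linear)
  have "((\<lambda>x. A x + b x x) has_derivative A) (at 0)"
    by (rule derivative_eq_intros bounded_linear_imp_has_derivative[OF A'] b.FDERIV has_derivative_ident | simp add: b.zero_left b.zero_right)+
  moreover have "((\<lambda>x. inverse (1 + g x x)) has_derivative (\<lambda>_. 0)) (at 0)"
    by (rule derivative_eq_intros g.FDERIV has_derivative_ident | simp add: g.zero_left g.zero_right)+
  ultimately have "((\<lambda>x. (A x + b x x) /\<^sub>R (1 + g x x)) has_derivative
     (\<lambda>h. inverse (1 + g 0 0) *\<^sub>R A h + 0 *\<^sub>R (A 0 + b 0 0))) (at 0)"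
    by (intro has_derivative_scaleR)
  then show ?thesis by (simp add: g.zero_left)
qed

lemma has_derivative_at_0_if_quadratic_error:
  fixes f A :: "'a::euclidean_space \<Rightarrow> 'b::real_normed_vector"
  assumes "linear A" "f 0 = 0" "\<rho> > 0" and err: "\<And>x. norm x \<le> \<rho> \<Longrightarrow> norm (f x - A x) \<le> M * (norm x)\<^sup>2"
  shows "(f has_derivative A) (at 0)"
proof (rule has_derivativeI_sandwich[where H = "\<lambda>x. M * norm x"])
  show "bounded_linear A" using assms(1) by (simp add: linear_linear)
  show "((\<lambda>x::'a. M * norm x) \<longlongrightarrow> 0) (at 0)"
    by (auto intro!: tendsto_eq_intros)
  fix y :: 'a assume "y \<noteq> 0" "dist y 0 < \<rho>"
  then show "norm (f y - f 0 - A (y - 0)) / norm (y - 0) \<le> M * norm y"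
    using err[of y] assms(2) by (simp add: divide_le_eq power2_eq_square mult.assoc)
qed (use assms in auto)

text \<open>Gram-Schmidt applied to two non-proportional values of \<open>A\<close> and lifted to
  the source; they exist because the range is not contained in a line.\<close>

lemma two_orthogonal_values:
  fixes A :: "real ^ 'm \<Rightarrow> real ^ 'n"
  assumes A: "linear A" and rank: "dim (range A) \<ge> 2"
  obtains e w where "A e \<bullet> A e = 1" "A e \<bullet> A w = 0" "A w \<noteq> 0"
proof -
  have "\<exists>y. A y \<notin> span {v}" for v
  proof (rule ccontr)
    assume "\<not> (\<exists>y. A y \<notin> span {v})"
    then have "dim (range A) \<le> card {v}" by (intro dim_le_card) auto
    with rank show False by simp
  qed
  \<comment> \<open>The previous fact is used first for \<open>v = 0\<close> and then for
    \<open>v = A x\<close>.\<close>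
  then obtain x y where "A x \<notin> span {0}" and y: "A y \<notin> span {A x}" by metis
  then have x: "A x \<noteq> 0" by auto
  define e where "e = x /\<^sub>R norm (A x)"
  define w where "w = y - (A e \<bullet> A y) *\<^sub>R e"
  have Ae: "A e = A x /\<^sub>R norm (A x)" by (simp add: e_def linear_scale[OF A])
  then have 1: "A e \<bullet> A e = 1"
    using x by (simp add: power2_norm_eq_inner[symmetric] power2_eq_square)
  have Aw: "A w = A y - (A e \<bullet> A y) *\<^sub>R A e"
    by (simp add: w_def linear_diff[OF A] linear_scale[OF A])
  then have "A e \<bullet> A w = 0" by (simp add: inner_simps 1)
  moreover have "A w \<noteq> 0"
  proof
    assume "A w = 0"
    then have "A y = (A e \<bullet> A y) *\<^sub>R A e" using Aw by simp
    also have "\<dots> = ((A e \<bullet> A y) / norm (A x)) *\<^sub>R A x" by (simp add: Ae divide_inverse)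
    also have "\<dots> \<in> span {A x}" by (intro span_mul span_base) simp
    finally show False using y by simp
  qed
  ultimately show ?thesis using that 1 by blast
qed

theorem theorem0p1:
  fixes \<Phi> :: "real ^ 'm \<Rightarrow> real ^ 'n"
  assumes "rounding \<Phi>"
  shows "\<exists>\<Psi> :: real ^ 'm \<Rightarrow> real ^ 'n.
           fractional_quadratic_rounding \<Psi> \<and> equivalent_roundings \<Phi> \<Psi>"
proof -
  from assms have an: "real_analytic_at \<Phi> 0" and \<Phi>0: "\<Phi> 0 = 0" and rank: "rank_at_0 \<Phi> \<ge> 2"
    and circ: "\<And>l. vector_line l \<Longrightarrow> \<exists>C. is_circle C \<and> germ_image_in \<Phi> l C"
    by (auto simp: rounding_def)
  obtain h \<rho> where \<rho>: "\<rho> > 0" and hom: "\<And>k. homogeneous k (h k)"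
    and rem: "\<And>K. \<exists>M. \<forall>x. norm x \<le> \<rho> \<longrightarrow> norm (\<Phi> x - (\<Sum>k<K. h k x)) \<le> M * norm x ^ K"
    by (rule real_analytic_at_taylor[OF an]) (rule that)
  define A where "A = h 1"
  have A: "linear A" using homogeneous_linear[of A] hom[of 1] by (simp add: A_def)
  obtain b where b: "bilinear b" "\<And>x y. b x y = b y x" and h2: "\<And>x. h 2 x = b x x"
    by (rule homogeneous_quadratic[OF hom[of 2]]) (rule that)
  have h0: "h 0 x = 0" for x
  proof -
    obtain v where v: "h 0 = (\<lambda>_. v)" using hom[of 0] by auto
    obtain M where "\<forall>x. norm x \<le> \<rho> \<longrightarrow> norm (\<Phi> x - (\<Sum>k<1. h k x)) \<le> M * norm x ^ 1"
      using rem[of 1] by blast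
    from this[THEN spec, of 0] have "norm (\<Phi> 0 - h 0 0) \<le> 0" using \<rho> by simp
    then show ?thesis using \<Phi>0 v by simp
  qed
  have der: "(\<Phi> has_derivative A) (at 0)"
  proof -
    obtain M where "\<And>x. norm x \<le> \<rho> \<Longrightarrow> norm (\<Phi> x - (\<Sum>k<2. h k x)) \<le> M * norm x ^ 2"
      using rem[of 2] by blast
    then show ?thesis
      by (intro has_derivative_at_0_if_quadratic_error[where \<rho> = \<rho> and M = M] A \<Phi>0 \<rho>) (simp add: numeral_2_eq_2 h0 A_def)
  qed
  have rankA: "dim (range A) \<ge> 2"
    using rank frechet_derivative_at[OF der] by (simp add: rank_at_0_def)
  \<comment> \<open>Terms up to degree four are kept: the degree-four term yields the divisibility
    of \<open>b x x \<bullet> b x x\<close>.\<close>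
  obtain M where M: "\<And>x. norm x \<le> \<rho> \<Longrightarrow> norm (\<Phi> x - (\<Sum>k<5. h k x)) \<le> M * norm x ^ 5"
    using rem[of 5] by blast
  have exp: "norm (\<Phi> (t *\<^sub>R x) - (t *\<^sub>R A x + t\<^sup>2 *\<^sub>R b x x + t^3 *\<^sub>R h 3 x + t^4 *\<^sub>R h 4 x)) \<le> (M * norm x ^ 5) * \<bar>t\<bar> ^ 5"
    if "norm (t *\<^sub>R x) \<le> \<rho>" for t x
  proof -
    have "(\<Sum>k<5. h k (t *\<^sub>R x)) = t *\<^sub>R A x + t\<^sup>2 *\<^sub>R b x x + t^3 *\<^sub>R h 3 x + t^4 *\<^sub>R h 4 x"
      by (simp add: homogeneous_scaleR[OF hom] A_def h0 h2[symmetric] eval_nat_numeral)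
    then show ?thesis using M[OF that] by (simp add: power_mult_distrib mult_ac)
  qed
  have jet: "\<exists>\<delta>>0. \<forall>t. \<bar>t\<bar> \<le> \<delta> \<longrightarrow> \<Phi> (t *\<^sub>R x) \<in> K \<and>
      norm (\<Phi> (t *\<^sub>R x) - (t *\<^sub>R A x + t\<^sup>2 *\<^sub>R b x x + t^3 *\<^sub>R h 3 x + t^4 *\<^sub>R h 4 x)) \<le> (M * norm x ^ 5) * \<bar>t\<bar> ^ 5"
    if germ: "germ_image_in \<Phi> (span {x}) K" for x K
  proof -
    obtain \<delta> where \<delta>: "\<delta> > 0" "\<And>t. \<bar>t\<bar> \<le> \<delta> \<Longrightarrow> \<Phi> (t *\<^sub>R x) \<in> K"
      using germ_image_in_spanD[OF germ] by blast
    have nx: "norm x + 1 > 0" by (simp add: add_nonneg_pos)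
    have "norm (t *\<^sub>R x) \<le> \<rho>" if "\<bar>t\<bar> \<le> \<rho> / (norm x + 1)" for t
    proof -
      have "\<bar>t\<bar> * (norm x + 1) \<le> \<rho>" using that nx by (simp add: pos_le_divide_eq)
      then show ?thesis by (simp add: algebra_simps)
    qed
    then show ?thesis using \<delta> \<rho> nx exp
      by (intro exI[of _ "min \<delta> (\<rho> / (norm x + 1))"]) auto
  qed
  have wedge: "(A x \<bullet> A x) * (h 3 x $ i * A x $ j - h 3 x $ j * A x $ i) =
        2 * (A x \<bullet> b x x) * (b x x $ i * A x $ j - b x x $ j * A x $ i) \<and>
      (A x \<bullet> A x) * (h 4 x $ i * A x $ j - h 4 x $ j * A x $ i) =
        (b x x \<bullet> b x x + 2 * (A x \<bullet> h 3 x)) * (b x x $ i * A x $ j - b x x $ j * A x $ i)" for x i j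
  \<comment> \<open>Every term of both identities has a component of \<open>A x\<close> as a factor,
    so circles matter only where \<open>A x \<noteq> 0\<close>.\<close>
  proof (cases "A x = 0")
    case False
    then have "x \<noteq> 0" using linear_0[OF A] by auto
    then obtain K where K: "is_circle K" "germ_image_in \<Phi> (span {x}) K"
      using circ vector_line_iff_span by blast
    from jet[OF K(2)] obtain \<delta> where "\<delta> > 0" and *: "\<And>t. \<bar>t\<bar> \<le> \<delta> \<Longrightarrow> \<Phi> (t *\<^sub>R x) \<in> K"
      "\<And>t. \<bar>t\<bar> \<le> \<delta> \<Longrightarrow> norm (\<Phi> (t *\<^sub>R x) - (t *\<^sub>R A x + t\<^sup>2 *\<^sub>R b x x + t^3 *\<^sub>R h 3 x + t^4 *\<^sub>R h 4 x)) \<le> (M * norm x ^ 5) * \<bar>t\<bar> ^ 5"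
      by blast
    from circle_jet(1,2)[OF K(1) this(1,3,2) False] show ?thesis by blast
  qed simp
  obtain e w0 where ew: "A e \<bullet> A e = 1" "A e \<bullet> A w0 = 0" "A w0 \<noteq> 0"
    using two_orthogonal_values[OF A rankA] .
  obtain l g where l: "linear l" and g: "bilinear g" and F: "\<And>x. A x \<bullet> b x x = l x * (A x \<bullet> A x)"
    and G: "\<And>x. b x x \<bullet> b x x = g x x * (A x \<bullet> A x)"
    by (rule divisibility_by_norm_form[OF A b hom hom ew conjunct1[OF wedge] conjunct2[OF wedge]]) (rule that)
  \<comment> \<open>Off the diagonal the values only have to make \<open>b'\<close> and
    \<open>q\<close> bilinear; \<open>\<Psi>\<close> sees just \<open>b' x x\<close> and
    \<open>q x x\<close>.\<close>
  define b' where "b' x y = b x y - l x *\<^sub>R A y" for x y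
  define q where "q x y = g x y - l x * l y" for x y
  define \<Psi> where "\<Psi> x = (A x + b' x x) /\<^sub>R (1 + q x x)" for x
  note lin = linear_add[OF A] linear_scale[OF A] linear_add[OF l] linear_scale[OF l]
    bilinear_ladd[OF b(1)] bilinear_radd[OF b(1)] bilinear_lmul[OF b(1)] bilinear_rmul[OF b(1)]
    bilinear_ladd[OF g] bilinear_radd[OF g] bilinear_lmul[OF g] bilinear_rmul[OF g]
  have b': "bilinear b'" unfolding bilinear_def b'_def
    by (intro conjI allI linearI) (simp_all add: lin algebra_simps)
  have q: "bilinear q" unfolding bilinear_def q_def
    by (intro conjI allI linearI) (simp_all add: lin algebra_simps)
  have orth: "A x \<bullet> (b x x - l x *\<^sub>R A x) = 0" for x
    by (simp add: inner_simps F)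
  \<comment> \<open>Expanding the square, the mixed term contributes
    \<open>- 2 * (l x)\<^sup>2\<close> and the last one \<open>(l x)\<^sup>2\<close>, each times
    \<open>A x \<bullet> A x\<close>.\<close>
  have norm_b': "(b x x - l x *\<^sub>R A x) \<bullet> (b x x - l x *\<^sub>R A x) = q x x * (A x \<bullet> A x)" for x
    using F[of x] G[of x] by (simp add: q_def inner_simps inner_commute[of "b x x" "A x"] algebra_simps)
  have common: "\<exists>C. is_circle C \<and> germ_image_in \<Phi> k C \<and> germ_image_in \<Psi> k C" if "vector_line k" for k
  proof -
    from that obtain x where x: "x \<noteq> 0" "k = span {x}" unfolding vector_line_iff_span by blast
    from circ[OF that] obtain K where K: "is_circle K" "germ_image_in \<Phi> (span {x}) K" unfolding x by blast
    from jet[OF K(2)] obtain \<delta> where \<delta>: "\<delta> > 0" and *: "\<And>t. \<bar>t\<bar> \<le> \<delta> \<Longrightarrow> \<Phi> (t *\<^sub>R x) \<in> K"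
      "\<And>t. \<bar>t\<bar> \<le> \<delta> \<Longrightarrow> norm (\<Phi> (t *\<^sub>R x) - (t *\<^sub>R A x + t\<^sup>2 *\<^sub>R b x x + t^3 *\<^sub>R h 3 x + t^4 *\<^sub>R h 4 x)) \<le> (M * norm x ^ 5) * \<bar>t\<bar> ^ 5"
      by blast
    have "\<Psi> (t *\<^sub>R x) \<in> K" for t
    proof -
      have \<Psi>t: "\<Psi> (t *\<^sub>R x) = (t *\<^sub>R A x + t\<^sup>2 *\<^sub>R (b x x - l x *\<^sub>R A x)) /\<^sub>R (1 + t\<^sup>2 * q x x)"
        by (simp add: \<Psi>_def b'_def lin bilinear_lmul[OF q] bilinear_rmul[OF q] power2_eq_square algebra_simps)
      show ?thesis
      proof (cases "A x = 0")
        case True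
        \<comment> \<open>On a line in the kernel of \<open>A\<close> the numerator of
          \<open>\<Psi>\<close> vanishes, so \<open>\<Psi>\<close> maps it to \<open>0\<close>,
          which lies on the circle of \<open>\<Phi>\<close>.\<close>
        then have "b x x - l x *\<^sub>R A x = 0" using norm_b'[of x] by simp
        then show ?thesis using *(1)[of 0] \<delta> True by (simp add: \<Psi>t \<Phi>0)
      next
        case False
        show ?thesis unfolding \<Psi>t
          by (rule circle_jet(3)[OF K(1) \<delta> *(2,1) False orth norm_b'])
      qed
    qed
    \<comment> \<open>The inclusion holds for every real \<open>t\<close>, so the whole space serves
      as neighbourhood.\<close>
    then have "germ_image_in \<Psi> k K"
      unfolding germ_image_in_def x span_singleton by (intro exI[of _ UNIV]) auto
    with K x show ?thesis by blast
  qed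
  have "rounding \<Psi>" unfolding rounding_def
  proof (intro conjI allI impI)
    show "real_analytic_at \<Psi> 0"
      unfolding \<Psi>_def[abs_def] by (rule real_analytic_at_0_quadratic_divide[OF A b' q])
    show "\<Psi> 0 = 0" by (simp add: \<Psi>_def linear_0[OF A] bilinear_lzero[OF b'])
    show "\<exists>C. is_circle C \<and> germ_image_in \<Psi> k C" if "vector_line k" for k
      using common[OF that] by blast
    have "(\<Psi> has_derivative A) (at 0)"
      unfolding \<Psi>_def[abs_def] by (rule has_derivative_quadratic_divide[OF A b' q])
    from frechet_derivative_at[OF this] show "2 \<le> rank_at_0 \<Psi>"
      using rankA by (simp add: rank_at_0_def)
  qed
  moreover have "\<exists>(P :: real ^ 'm \<Rightarrow> real ^ 'n) (Q :: real ^ 'm \<Rightarrow> real).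
        (\<forall>k. quadratic_polynomial (\<lambda>x. P x $ k)) \<and> quadratic_polynomial Q \<and> Q 0 \<noteq> 0 \<and>
        \<Psi> = (\<lambda>x. P x /\<^sub>R Q x)"
  proof (intro exI conjI allI)
    show "\<Psi> = (\<lambda>x. (A x + b' x x) /\<^sub>R (1 + q x x))" by (simp add: \<Psi>_def fun_eq_iff)
    show "1 + q 0 0 \<noteq> 0" by (simp add: bilinear_lzero[OF q])
    have "linear (\<lambda>x::real ^ 'm. 0 :: real)" by (simp add: linear_iff)
    from quadratic_polynomial_bilinear[OF this q, of 1] show "quadratic_polynomial (\<lambda>x. 1 + q x x)"
      by (simp add: add.commute)
    fix i
    have "linear (\<lambda>x. A x $ i)" by (intro linearI) (simp_all add: lin)
    moreover have "bilinear (\<lambda>x y. b' x y $ i)"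
      unfolding bilinear_def using b'
      by (auto intro!: linearI simp: bilinear_ladd bilinear_radd bilinear_lmul bilinear_rmul)
    ultimately show "quadratic_polynomial (\<lambda>x. (A x + b' x x) $ i)"
      using quadratic_polynomial_bilinear[of "\<lambda>x. A x $ i" "\<lambda>x y. b' x y $ i" 0] by simp
  qed
  moreover have "equivalent_roundings \<Phi> \<Psi>"
    unfolding equivalent_roundings_def using common by blast
  ultimately show ?thesis unfolding fractional_quadratic_rounding_def by blast
qed

end
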